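(* Let $d,L\ge 1$ and $n\ge 0$ be integers. Let $\alpha\in\Lambda_{d,L}$, let $\mathbf{x}=(x_1,\dots,x_d)\in\Delta_{d,L}$ where $x_i=\alpha_{i-1}-\alpha_i$ for $i\in[d]$, and let $u=0^{x_1}10^{x_2}1\cdots 0^{x_d}1$. Let $\alpha'\in\Lambda_{L,d}$ be the conjugate of $\alpha$, let $\mathbf{y}=(y_1,\dots,y_L)\in\Delta_{L,d}$ where $y_j=\alpha'_{j-1}-\alpha'_j$ for $j\in[L]$, and let $u^{rc}$ be the reverse-complement of $u$. There are explicit bijections between the sets (a) $\mathrm{SCT}^n_{d,L}(\cdot/\alpha)$, the set of standard cylindric tableaux of period $(d,L)$ with $n$ cells and inner shape $\alpha$; (b) $\mathcal{W}^n_{d,L}(\mathbf{x})$, the set of $n$-step walks in $\mathcal{D}_{d,L}$ starting at $\mathbf{x}$; (c) the set of $n$-step walks in $\mathcal{E}_{d,L}$ starting at state $u$; (d) the set of $n$-step walks in $\mathcal{N}_{d,L}$ starting at state $[\![u]\!]$; and the following sets: (a') $\mathrm{SCT}^n_{L,d}(\cdot/\alpha')$, the set of standard cylindric tableaux of period $(L,d)$ with $n$ cells and inner shape $\alpha'$; (b') $\mathcal{W}^n_{L,d}(\mathbf{y})$, the set of $n$-step walks in $\mathcal{D}_{L,d}$ starting at $\mathbf{y}$; (c') the set of $n$-step walks in $\mathcal{E}_{L,d}$ starting at state $u^{rc}$; (d') the set of $n$-step walks in $\mathcal{N}_{L,d}$ starting at state $[\![u^{rc}]\!]$.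
   Context: All notation below is for arbitrary integers $d,L\ge1$ (and is also used with the roles of $d$ and $L$ exchanged). $[d]=\{1,\dots,d\}$, $\mathbb{N}$ is the set of nonnegative integers; in strings, exponents denote repetition. Cylindric shapes and tableaux. The cylinder is $\mathcal{C}_{d,L}=\mathbb{Z}^2/(-d,L)\mathbb{Z}$; its elements (cells) are classes $\langle i,j\rangle=(i,j)+(-d,L)\mathbb{Z}$, where $i$ is the row and $j$ the column. A cylindric shape of period $(d,L)$ is a doubly infinite weakly decreasing integer sequence $\lambda=(\lambda_i)_{i\in\mathbb{Z}}$ with $\lambda_i=\lambda_{i+d}+L$ for all $i$. $\Lambda_{d,L}$ is the set of these. Its Young diagram is $Y_\lambda=\{\langle i,j\rangle: j\le\lambda_i\}$. Write $\mu\subseteq\lambda$ if $\mu_i\le\lambda_i$ for all $i$; then $Y_{\lambda/\mu}=Y_\lambda\setminus Y_\mu$, with cardinality $|\lambda/\mu|=\sum_{i=1}^d(\lambda_i-\mu_i)$. A standard cylindric tableau of period $(d,L)$ and shape $\lambda/\mu$ (outer shape $\lambda$, inner shape $\mu$, with $|\lambda/\mu|$ cells) is a filling of the cells of $Y_{\lambda/\mu}$ with $1,2,\dots,|\lambda/\mu|$, each used exactly once, with entries increasing along rows (from $\langle i,j\rangle$ to $\langle i,j+1\rangle$) and along columns (from $\langle i,j\rangle$ to $\langle i+1,j\rangle$). $\mathrm{SCT}^n_{d,L}(\cdot/\alpha)$ is the set of those with $n$ cells and inner shape $\alpha$. Conjugate: for $\lambda\in\Lambda_{d,L}$, the conjugate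 $\lambda'\in\Lambda_{L,d}$ is given by $\lambda'_j=\max\{i:\lambda_i\ge j\}$ for all $j\in\mathbb{Z}$. Simplices. $\Delta_{d,L}=\{(x_1,\dots,x_d)\in\mathbb{N}^d: x_1+\cdots+x_d=L\}$. With $e_i$ the unit coordinate vectors and $e_{d+1}=e_1$, let $s_i=e_{i+1}-e_i$ for $i\in[d]$. $\mathcal{D}_{d,L}$ is the directed graph with vertex set $\Delta_{d,L}$ and an edge from $\mathbf{x}$ to $\mathbf{y}$ whenever $\mathbf{y}-\mathbf{x}=s_i$ for some $i\in[d]$. Exclusion process (TASEP). Let $N=d+L$. $\mathcal{E}_{d,L}$ is the directed graph whose vertices (states) are the binary strings $u_1\cdots u_N$ with exactly $d$ ones, with indices modulo $N$, and with an edge from $u$ to $v$ iff there is $r$ such that $u_{r-1}u_r=01$, $v_{r-1}v_r=10$, and $u_t=v_t$ for all $t\in\mathbb{Z}_N\setminus\{r-1,r\}$. $\mathcal{N}_{d,L}$ is the directed multigraph whose vertices are the necklaces $[\![u]\!]$, i.e. equivalence classes of states under cyclic rotation; the number of edges from $[\![u]\!]$ to $[\![v]\!]$ is the number of $\tilde v\in[\![v]\!]$ such that $\mathcal{E}_{d,L}$ has an edge from $u$ to $\tilde v$ (independent of the representative $u$). The reverse-complement $u^{rc}$ of $u=u_1\cdots u_N$ is given by $u^{rc}_k=1-u_{N+1-k}$ for all $k$. A walk in a directed (multi)graph is a sequence of consecutive edges, each traversed in its forward direction; parallel edges are distinguished. *)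

theory Defs
  imports "HOL-Library.FuncSet" "Graph_Theory.Arc_Walk"
begin

section \<open>Cylindric shapes and tableaux\<close>

definition cylindric_shapes :: "nat \<Rightarrow> nat \<Rightarrow> (int \<Rightarrow> int) set" where
  "cylindric_shapes d L = {\<nu>. antimono \<nu> \<and> (\<forall>i. \<nu> i = \<nu> (i + int d) + int L)}"

type_synonym cell = "(int \<times> int) set"

definition cell :: "nat \<Rightarrow> nat \<Rightarrow> int \<Rightarrow> int \<Rightarrow> cell" where
  "cell d L i j = {(i - k * int d, j + k * int L) | k. True}"

definition young :: "nat \<Rightarrow> nat \<Rightarrow> (int \<Rightarrow> int) \<Rightarrow> cell set" where
  "young d L \<nu> = {cell d L i j | i j. j \<le> \<nu> i}"

definition skew_young :: "nat \<Rightarrow> nat \<Rightarrow> (int \<Rightarrow> int) \<Rightarrow> (int \<Rightarrow> int) \<Rightarrow> cell set" where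
  "skew_young d L \<nu> \<mu> = young d L \<nu> - young d L \<mu>"

definition skew_size :: "nat \<Rightarrow> (int \<Rightarrow> int) \<Rightarrow> (int \<Rightarrow> int) \<Rightarrow> int" where
  "skew_size d \<nu> \<mu> = (\<Sum>i = 1..int d. \<nu> i - \<mu> i)"

text \<open>
  A tableau with inner shape \<open>\<alpha>\<close> is represented by its outer shape together with
  its filling; the filling is undefined outside the diagram, so that equality of
  representations is equality of tableaux. The order \<open>\<alpha> \<le> \<nu>\<close> is pointwise.
\<close>

definition SCT ::
  "nat \<Rightarrow> nat \<Rightarrow> nat \<Rightarrow> (int \<Rightarrow> int) \<Rightarrow> ((int \<Rightarrow> int) \<times> (cell \<Rightarrow> nat)) set" where
  "SCT d L n \<alpha> = {(\<nu>, T).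
     \<nu> \<in> cylindric_shapes d L \<and> \<alpha> \<le> \<nu> \<and> skew_size d \<nu> \<alpha> = int n \<and>
     T \<in> extensional (skew_young d L \<nu> \<alpha>) \<and>
     bij_betw T (skew_young d L \<nu> \<alpha>) {1..n} \<and>
     (\<forall>i j. cell d L i j \<in> skew_young d L \<nu> \<alpha> \<and> cell d L i (j + 1) \<in> skew_young d L \<nu> \<alpha> \<longrightarrow>
        T (cell d L i j) < T (cell d L i (j + 1))) \<and>
     (\<forall>i j. cell d L i j \<in> skew_young d L \<nu> \<alpha> \<and> cell d L (i + 1) j \<in> skew_young d L \<nu> \<alpha> \<longrightarrow>
        T (cell d L i j) < T (cell d L (i + 1) j))}"

definition conjugate :: "(int \<Rightarrow> int) \<Rightarrow> int \<Rightarrow> int" where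
  "conjugate \<nu> j = (GREATEST i. \<nu> i \<ge> j)"


section \<open>Walks\<close>

text \<open>
  Walks are lists of arcs, so parallel arcs are distinguished.
\<close>

definition walks_from :: "('v, 'e) pre_digraph \<Rightarrow> nat \<Rightarrow> 'v \<Rightarrow> 'e list set" where
  "walks_from G n v = {p. length p = n \<and> (\<exists>w. pre_digraph.awalk G v p w)}"


section \<open>The simplex graph\<close>

text \<open>
  Vectors \<open>(x\<^sub>1, \<dots>, x\<^sub>d)\<close> are lists, so \<open>x\<^sub>i\<close> is \<open>x ! (i - 1)\<close>. Likewise
  \<open>simplex_step d i\<close> is the vector \<open>s\<close> with (one-based) index \<open>i + 1\<close>,
  for \<open>i < d\<close>; for \<open>d = 1\<close> it is zero and the graph has loops.
\<close>

definition simplex :: "nat \<Rightarrow> nat \<Rightarrow> nat list set" where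
  "simplex d L = {x. length x = d \<and> sum_list x = L}"

definition unit_vec :: "nat \<Rightarrow> nat \<Rightarrow> int" where
  "unit_vec i k = (if k = i then 1 else 0)"

definition simplex_step :: "nat \<Rightarrow> nat \<Rightarrow> nat \<Rightarrow> int" where
  "simplex_step d i k = unit_vec (Suc i mod d) k - unit_vec i k"

definition simplex_graph :: "nat \<Rightarrow> nat \<Rightarrow> (nat list, nat list \<times> nat list) pre_digraph" where
  "simplex_graph d L = \<lparr>
     verts = simplex d L,
     arcs = {(x, y). x \<in> simplex d L \<and> y \<in> simplex d L \<and>
       (\<exists>i<d. \<forall>k<d. int (y ! k) - int (x ! k) = simplex_step d i k)},
     tail = fst, head = snd\<rparr>"


section \<open>The exclusion process on states and on necklaces\<close>

text \<open>
  The binary string \<open>u\<^sub>1 \<dots> u\<^sub>N\<close> is a list of Booleans with \<open>True\<close> for \<open>1\<close>,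
  so \<open>u\<^sub>r\<close> is \<open>u ! (r - 1)\<close>.
\<close>

definition states :: "nat \<Rightarrow> nat \<Rightarrow> bool list set" where
  "states d L = {u. length u = d + L \<and> count_list u True = d}"

text \<open>A particle at the cyclic successor \<open>q\<close> of an empty site \<open>p\<close> jumps to \<open>p\<close>.\<close>

definition hop :: "bool list \<Rightarrow> bool list \<Rightarrow> bool" where
  "hop u v \<longleftrightarrow> length v = length u \<and>
     (\<exists>p<length u. \<exists>q. q = Suc p mod length u \<and>
        \<not> u ! p \<and> u ! q \<and> v ! p \<and> \<not> v ! q \<and>
        (\<forall>t<length u. t \<noteq> p \<and> t \<noteq> q \<longrightarrow> u ! t = v ! t))"

definition state_graph :: "nat \<Rightarrow> nat \<Rightarrow> (bool list, bool list \<times> bool list) pre_digraph" where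
  "state_graph d L = \<lparr>
     verts = states d L,
     arcs = {(u, v). u \<in> states d L \<and> v \<in> states d L \<and> hop u v},
     tail = fst, head = snd\<rparr>"

definition necklace :: "bool list \<Rightarrow> bool list set" where
  "necklace u = {rotate k u | k. True}"

text \<open>
  The choice of the representative \<open>u\<close> of \<open>P\<close> is irrelevant, since \<open>hop\<close> is
  invariant under simultaneous rotation of both strings.
\<close>

definition edge_mult :: "bool list set \<Rightarrow> bool list set \<Rightarrow> nat" where
  "edge_mult P Q = card {v \<in> Q. hop (SOME u. u \<in> P) v}"

text \<open>The parallel edges from \<open>P\<close> to \<open>Q\<close> are numbered \<open>0, \<dots>, edge_mult P Q - 1\<close>.\<close>

definition necklace_graph ::
  "nat \<Rightarrow> nat \<Rightarrow> (bool list set, bool list set \<times> nat \<times> bool list set) pre_digraph" where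
  "necklace_graph d L = \<lparr>
     verts = necklace ` states d L,
     arcs = {(P, k, Q). P \<in> necklace ` states d L \<and> Q \<in> necklace ` states d L \<and>
       k < edge_mult P Q},
     tail = (\<lambda>(P, k, Q). P), head = (\<lambda>(P, k, Q). Q)\<rparr>"

definition rev_compl :: "bool list \<Rightarrow> bool list" where
  "rev_compl u = rev (map Not u)"


section \<open>Vertices associated with a shape\<close>

definition gaps :: "nat \<Rightarrow> (int \<Rightarrow> int) \<Rightarrow> nat list" where
  "gaps d \<alpha> = map (\<lambda>i. nat (\<alpha> (i - 1) - \<alpha> i)) [1..int d]"

definition gap_string :: "nat list \<Rightarrow> bool list" where
  "gap_string x = concat (map (\<lambda>k. replicate k False @ [True]) x)"


section \<open>The explicit bijections\<close>

text \<open>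
  A tableau with \<open>n\<close> cells amounts to a chain \<open>stage \<dots> 0, \<dots>, stage \<dots> n\<close> of shapes,
  the shape \<open>stage \<dots> k\<close> being \<open>\<alpha>\<close> together with the cells with entry at most \<open>k\<close>.
\<close>

definition stage ::
  "nat \<Rightarrow> nat \<Rightarrow> (int \<Rightarrow> int) \<Rightarrow> (int \<Rightarrow> int) \<times> (cell \<Rightarrow> nat) \<Rightarrow> nat \<Rightarrow> int \<Rightarrow> int" where
  "stage d L \<alpha> = (\<lambda>(\<nu>, T) k i.
     \<alpha> i + int (card {j. \<alpha> i < j \<and> j \<le> \<nu> i \<and> T (cell d L i j) \<le> k}))"

definition path_through :: "(nat \<Rightarrow> 'v) \<Rightarrow> nat \<Rightarrow> ('v \<times> 'v) list" where
  "path_through f n = map (\<lambda>k. (f k, f (Suc k))) [0..<n]"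

text \<open>
  If entry \<open>k\<close> lies in row \<open>i \<in> [d]\<close>, then the \<open>k\<close>th step of the walk is \<open>s\<^sub>i\<close>.
\<close>

definition tableau_to_simplex_walk ::
  "nat \<Rightarrow> nat \<Rightarrow> nat \<Rightarrow> (int \<Rightarrow> int) \<Rightarrow> (int \<Rightarrow> int) \<times> (cell \<Rightarrow> nat) \<Rightarrow> (nat list \<times> nat list) list"
  where
  "tableau_to_simplex_walk d L n \<alpha> T = path_through (\<lambda>k. gaps d (stage d L \<alpha> T k)) n"

text \<open>
  In the state of the shape \<open>\<nu>\<close> (with origin \<open>a\<close>), particle \<open>i\<close> sits at site
  \<open>i + a - \<nu>\<^sub>i\<close>. Here \<open>i\<close> ranges over all integers, which accounts for the
  reduction of the sites modulo \<open>N = d + L\<close>. With \<open>\<nu> = \<alpha>\<close> and \<open>a = \<alpha>\<^sub>0\<close>, particle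
  \<open>i \<in> [d]\<close> is at site \<open>i + x\<^sub>1 + \<cdots> + x\<^sub>i\<close>, so the state is
  \<open>gap_string (gaps d \<alpha>)\<close>. Adding a cell in row \<open>i\<close> makes particle \<open>i\<close> jump left.
\<close>

definition shape_state :: "nat \<Rightarrow> nat \<Rightarrow> int \<Rightarrow> (int \<Rightarrow> int) \<Rightarrow> bool list" where
  "shape_state d L a \<nu> = map (\<lambda>p. \<exists>i. p = i + a - \<nu> i) [1..int (d + L)]"

definition tableau_to_state_walk ::
  "nat \<Rightarrow> nat \<Rightarrow> nat \<Rightarrow> (int \<Rightarrow> int) \<Rightarrow> (int \<Rightarrow> int) \<times> (cell \<Rightarrow> nat) \<Rightarrow> (bool list \<times> bool list) list"
  where
  "tableau_to_state_walk d L n \<alpha> T =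
     path_through (\<lambda>k. shape_state d L (\<alpha> 0) (stage d L \<alpha> T k)) n"

text \<open>
  An arc from \<open>u\<close> to \<open>v\<close> projects to the arc between the necklaces whose number is the
  lexicographic rank of \<open>v\<close> among the strings of its necklace that \<open>u\<close> can hop to.
\<close>

definition project_arc ::
  "bool list \<times> bool list \<Rightarrow> bool list set \<times> nat \<times> bool list set" where
  "project_arc = (\<lambda>(u, v).
     (necklace u,
      card {w \<in> necklace v. hop u w \<and> (w, v) \<in> lexord {(False, True)}},
      necklace v))"

definition state_walk_to_necklace_walk ::
  "(bool list \<times> bool list) list \<Rightarrow> (bool list set \<times> nat \<times> bool list set) list" where
  "state_walk_to_necklace_walk = map project_arc"

definition rev_compl_walk :: "(bool list \<times> bool list) list \<Rightarrow> (bool list \<times> bool list) list" where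
  "rev_compl_walk = map (map_prod rev_compl rev_compl)"

text \<open>
  Reflection in the main diagonal: \<open>(`) prod.swap\<close> maps the class of \<open>(i, j)\<close> modulo
  \<open>(-d, L)\<close> to the class of \<open>(j, i)\<close> modulo \<open>(-L, d)\<close>.
\<close>

definition conjugate_tableau ::
  "nat \<Rightarrow> nat \<Rightarrow> (int \<Rightarrow> int) \<Rightarrow> (int \<Rightarrow> int) \<times> (cell \<Rightarrow> nat) \<Rightarrow> (int \<Rightarrow> int) \<times> (cell \<Rightarrow> nat)"
  where
  "conjugate_tableau d L \<alpha> = (\<lambda>(\<nu>, T).
     (conjugate \<nu>,
      restrict (\<lambda>c. T (prod.swap ` c)) (skew_young L d (conjugate \<nu>) (conjugate \<alpha>))))"

end

theory Submission
  imports Defs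
begin

text \<open>
  A standard tableau with inner shape \<open>\<alpha>\<close> records the order in which cells are added to
  \<open>\<alpha>\<close>, so it is the same thing as a walk in the graph whose vertices are all cylindric
  shapes and whose arcs add one cell (\<open>tableaux_bij_betw_shape_walks\<close>). This uses
  that, by monotonicity along rows and columns, the cells with entry at most \<open>k\<close>
  together with \<open>\<alpha>\<close> form a shape for every \<open>k\<close>.

  The sets of walks are obtained from walks in such graphs by coverings. If a map of graphs is
  bijective on the arcs leaving each vertex, then each walk in the target has exactly one
  lift with a given start (\<open>covering_bij_betw_walks\<close>). It therefore
  suffices to compare single steps, and four coverings are needed.
  \<^item> From shapes to the simplex: a cell can be added in row \<open>i\<close> iff row \<open>i\<close> is shorter than
    row \<open>i - 1\<close>, that is, iff \<open>x\<^sub>i > 0\<close>, and this addition is the step \<open>s\<^sub>i\<close>.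
  \<^item> From shapes to states of the exclusion process: the particles \<open>i - \<nu>\<^sub>i\<close> form a strictly
    increasing sequence with \<open>d\<close> terms in each period \<open>d + L\<close>, and a cell can be added in row
    \<open>i\<close> iff the site to the left of particle \<open>i\<close> is empty, in which case the particle
    jumps there.
  \<^item> From states to necklaces: the multiplicities are defined so that the arcs leaving the
    necklace of \<open>u\<close> are in bijection with the hops of \<open>u\<close>.
  \<^item> From states to their reverse-complements, an isomorphism.

  Conjugation reflects the diagram of a shape in the diagonal and exchanges the two
  monotonicity conditions on tableaux, so it is a bijection on tableaux, with inverse
  the conjugation for the exchanged period.
\<close>


section \<open>Walks\<close>

lemma walks_from_0: "walks_from G 0 v = (if v \<in> verts G then {[]} else {})"
  by (auto simp: walks_from_def pre_digraph.awalk_def pre_digraph.cas.simps)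

lemma walks_from_Suc:
  assumes "v \<in> verts G" and "head G ` arcs G \<subseteq> verts G"
  shows "walks_from G (Suc n) v =
    (\<Union>e \<in> out_arcs G v. (#) e ` walks_from G n (head G e))"
proof -
  have walk_Cons: "e # q \<in> walks_from G (Suc n) v \<longleftrightarrow>
      e \<in> out_arcs G v \<and> q \<in> walks_from G n (head G e)" for e q
    using assms by (auto simp: walks_from_def pre_digraph.awalk_def pre_digraph.cas.simps)
  have "p \<in> walks_from G (Suc n) v \<longleftrightarrow>
      (\<exists>e q. p = e # q \<and> e \<in> out_arcs G v \<and> q \<in> walks_from G n (head G e))" for p
  proof (cases p)
    case Nil
    then show ?thesis by (simp add: walks_from_def)
  next
    case (Cons e q)
    then show ?thesis by (simp add: walk_Cons)
  qed
  then show ?thesis by blast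
qed

text \<open>
  Walks lift uniquely along a map of graphs that is bijective on the arcs leaving each
  vertex, because the lift is determined one arc at a time.
\<close>

definition covering ::
  "('v, 'e) pre_digraph \<Rightarrow> ('w, 'f) pre_digraph \<Rightarrow> ('v \<Rightarrow> 'w) \<Rightarrow> ('e \<Rightarrow> 'f) \<Rightarrow> bool" where
  "covering G H \<phi> \<psi> \<longleftrightarrow>
     \<phi> ` verts G \<subseteq> verts H \<and>
     head G ` arcs G \<subseteq> verts G \<and> head H ` arcs H \<subseteq> verts H \<and>
     (\<forall>e \<in> arcs G. head H (\<psi> e) = \<phi> (head G e)) \<and>
     (\<forall>v \<in> verts G. bij_betw \<psi> (out_arcs G v) (out_arcs H (\<phi> v)))"

lemma covering_bij_betw_walks:
  assumes "covering G H \<phi> \<psi>" and "v \<in> verts G"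
  shows "bij_betw (map \<psi>) (walks_from G n v) (walks_from H n (\<phi> v))"
  using assms(2)
proof (induction n arbitrary: v)
  case 0
  then show ?case
    using assms(1) by (auto simp: walks_from_0 covering_def bij_betw_def)
next
  case (Suc n)
  note cov = assms(1)[unfolded covering_def]
  have wf: "head G ` arcs G \<subseteq> verts G" "head H ` arcs H \<subseteq> verts H" and \<phi>v: "\<phi> v \<in> verts H"
    using cov Suc.prems by blast+
  have bij: "bij_betw \<psi> (out_arcs G v) (out_arcs H (\<phi> v))"
    using cov Suc.prems by blast
  have IH: "bij_betw (map \<psi>) (walks_from G n (head G e)) (walks_from H n (head H (\<psi> e)))"
    if "e \<in> out_arcs G v" for e
  proof -
    have e: "e \<in> arcs G" using that by simp
    then have "head G e \<in> verts G" "head H (\<psi> e) = \<phi> (head G e)" using cov by blast+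
    then show ?thesis using Suc.IH by simp
  qed
  have G: "walks_from G (Suc n) v = (\<Union>e \<in> out_arcs G v. (#) e ` walks_from G n (head G e))"
    using Suc.prems wf(1) by (rule walks_from_Suc)
  have H: "walks_from H (Suc n) (\<phi> v) =
      (\<Union>f \<in> out_arcs H (\<phi> v). (#) f ` walks_from H n (head H f))"
    using \<phi>v wf(2) by (rule walks_from_Suc)
  have "inj_on (map \<psi>) (walks_from G (Suc n) v)"
  proof (rule inj_onI)
    fix p q assume "p \<in> walks_from G (Suc n) v" "q \<in> walks_from G (Suc n) v"
      and eq: "map \<psi> p = map \<psi> q"
    then obtain e p' f q' where *: "e \<in> out_arcs G v" "f \<in> out_arcs G v" "p = e # p'" "q = f # q'"
      "p' \<in> walks_from G n (head G e)" "q' \<in> walks_from G n (head G f)"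
      unfolding G by blast
    then have "e = f" using eq inj_onD[OF bij_betw_imp_inj_on[OF bij]] by simp
    moreover have "p' = q'"
      using inj_onD[OF bij_betw_imp_inj_on[OF IH[OF *(1)]], of p' q'] * \<open>e = f\<close> eq by simp
    ultimately show "p = q" using * by simp
  qed
  moreover have "map \<psi> ` walks_from G (Suc n) v = walks_from H (Suc n) (\<phi> v)"
  proof -
    have "map \<psi> ` walks_from G (Suc n) v =
        (\<Union>e \<in> out_arcs G v. (#) (\<psi> e) ` map \<psi> ` walks_from G n (head G e))"
      unfolding G by (simp add: image_UN image_image)
    also have "\<dots> = (\<Union>e \<in> out_arcs G v. (#) (\<psi> e) ` walks_from H n (head H (\<psi> e)))"
      using IH by (intro SUP_cong refl arg_cong[of _ _ "(`) _"] bij_betw_imp_surj_on)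
    also have "\<dots> = walks_from H (Suc n) (\<phi> v)"
      unfolding H bij_betw_imp_surj_on[OF bij, symmetric] by simp
    finally show ?thesis .
  qed
  ultimately show ?case by (simp add: bij_betw_def)
qed

text \<open>
  When arcs are pairs of vertices, the arc map is induced by the vertex map, and bijectivity
  on leaving arcs becomes bijectivity on out-neighbours.
\<close>

lemma coveringI_simple:
  assumes "\<phi> ` verts G \<subseteq> verts H"
    and "tail G = fst" "head G = snd" "tail H = fst" "head H = snd"
    and "snd ` arcs G \<subseteq> verts G" "snd ` arcs H \<subseteq> verts H"
    and "\<And>v w. v \<in> verts G \<Longrightarrow> (v, w) \<in> arcs G \<Longrightarrow> (\<phi> v, \<phi> w) \<in> arcs H"
    and "\<And>v w w'. v \<in> verts G \<Longrightarrow> (v, w) \<in> arcs G \<Longrightarrow> (v, w') \<in> arcs G \<Longrightarrow> \<phi> w = \<phi> w' \<Longrightarrow> w = w'"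
    and "\<And>v z. v \<in> verts G \<Longrightarrow> (\<phi> v, z) \<in> arcs H \<Longrightarrow> \<exists>w. (v, w) \<in> arcs G \<and> \<phi> w = z"
  shows "covering G H \<phi> (map_prod \<phi> \<phi>)"
proof -
  have "bij_betw (map_prod \<phi> \<phi>) (out_arcs G v) (out_arcs H (\<phi> v))" if v: "v \<in> verts G" for v
    unfolding bij_betw_def
  proof
    show "inj_on (map_prod \<phi> \<phi>) (out_arcs G v)"
      using assms(2,9) that by (auto simp: inj_on_def)
    show "map_prod \<phi> \<phi> ` out_arcs G v = out_arcs H (\<phi> v)"
    proof
      show "map_prod \<phi> \<phi> ` out_arcs G v \<subseteq> out_arcs H (\<phi> v)"
        using assms(2,4,8) that by auto
      show "out_arcs H (\<phi> v) \<subseteq> map_prod \<phi> \<phi> ` out_arcs G v"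
      proof
        fix e assume "e \<in> out_arcs H (\<phi> v)"
        then obtain z where e: "e = (\<phi> v, z)" "(\<phi> v, z) \<in> arcs H"
          using assms(4) by (cases e) auto
        then obtain w where "(v, w) \<in> arcs G" "\<phi> w = z" using assms(10) v by blast
        then show "e \<in> map_prod \<phi> \<phi> ` out_arcs G v"
          using e assms(2) by (intro image_eqI[of _ _ "(v, w)"]) auto
      qed
    qed
  qed
  then show ?thesis using assms(1-7) by (simp add: covering_def)
qed

text \<open>A walk whose arcs are pairs of vertices is given by its sequence of vertices.\<close>

lemma walks_from_simple:
  assumes "tail G = fst" "head G = snd" "v \<in> verts G"
  shows "p \<in> walks_from G n v \<longleftrightarrow>
    (\<exists>f. f 0 = v \<and> p = path_through f n \<and> (\<forall>k<n. (f k, f (Suc k)) \<in> arcs G))"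
proof -
  have cas: "(\<exists>w. pre_digraph.cas G v p w) \<longleftrightarrow> (\<exists>f. f 0 = v \<and> p = path_through f (length p))"
    for v p
  proof (induction p arbitrary: v)
    case Nil
    then show ?case
      by (auto simp: pre_digraph.cas.simps path_through_def)
  next
    case (Cons e p)
    have path_Suc: "path_through f (Suc m) = (f 0, f 1) # path_through (f \<circ> Suc) m" for f :: "nat \<Rightarrow> 'a" and m
      by (simp add: path_through_def upt_conv_Cons map_Suc_upt[symmetric] del: upt_Suc)
    have "(\<exists>w. pre_digraph.cas G v (e # p) w) \<longleftrightarrow>
        fst e = v \<and> (\<exists>g. g 0 = snd e \<and> p = path_through g (length p))"
      using Cons.IH assms by (simp add: pre_digraph.cas.simps)
    also have "\<dots> \<longleftrightarrow> (\<exists>f. f 0 = v \<and> e # p = path_through f (length (e # p)))"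
    proof
      assume "fst e = v \<and> (\<exists>g. g 0 = snd e \<and> p = path_through g (length p))"
      then obtain g where "fst e = v" "g 0 = snd e" "p = path_through g (length p)" by blast
      then show "\<exists>f. f 0 = v \<and> e # p = path_through f (length (e # p))"
        by (intro exI[of _ "case_nat v g"]) (auto simp: path_Suc comp_def prod_eq_iff)
    next
      assume "\<exists>f. f 0 = v \<and> e # p = path_through f (length (e # p))"
      then obtain f where "f 0 = v" "e # p = path_through f (Suc (length p))" by auto
      then show "fst e = v \<and> (\<exists>g. g 0 = snd e \<and> p = path_through g (length p))"
        unfolding path_Suc by (auto intro!: exI[of _ "f \<circ> Suc"])
    qed
    finally show ?case .
  qed
  have arcs: "set (path_through f n) \<subseteq> arcs G \<longleftrightarrow> (\<forall>k<n. (f k, f (Suc k)) \<in> arcs G)" for f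
    by (auto simp: path_through_def image_subset_iff)
  have len: "length (path_through f n) = n" for f :: "nat \<Rightarrow> 'a"
    by (simp add: path_through_def)
  have "p \<in> walks_from G n v \<longleftrightarrow> length p = n \<and> set p \<subseteq> arcs G \<and>
      (\<exists>f. f 0 = v \<and> p = path_through f (length p))"
    unfolding cas[symmetric] using assms(3) by (auto simp: walks_from_def pre_digraph.awalk_def)
  also have "\<dots> \<longleftrightarrow> (\<exists>f. f 0 = v \<and> p = path_through f n \<and> (\<forall>k<n. (f k, f (Suc k)) \<in> arcs G))"
    unfolding arcs[symmetric] by (metis len)
  finally show ?thesis .
qed

lemma path_through_eq_iff:
  assumes "f 0 = g 0"
  shows "path_through f n = path_through g n \<longleftrightarrow> (\<forall>k\<le>n. f k = g k)"
proof
  assume eq: "path_through f n = path_through g n"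
  have "f k = g k \<and> f (Suc k) = g (Suc k)" if "k < n" for k
    using arg_cong[OF eq, of "\<lambda>p. p ! k"] that by (simp add: path_through_def)
  then show "\<forall>k\<le>n. f k = g k"
    using assms by (metis Suc_le_eq not0_implies_Suc)
qed (auto simp: path_through_def)

lemma map_path_through: "map (map_prod \<phi> \<phi>) (path_through f n) = path_through (\<lambda>k. \<phi> (f k)) n"
  by (simp add: path_through_def)


section \<open>Cells and shapes\<close>

lemma int_eqI: "(\<And>j::int. j \<le> a \<longleftrightarrow> j \<le> b) \<Longrightarrow> a = b"
  by (metis order_refl order_antisym)

lemma antimono_int_iff: "antimono (\<nu> :: int \<Rightarrow> int) \<longleftrightarrow> (\<forall>i. \<nu> i \<le> \<nu> (i - 1))"
proof
  assume step: "\<forall>i. \<nu> i \<le> \<nu> (i - 1)"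
  have "\<nu> j \<le> \<nu> i" if "i \<le> j" for i j
    using that
  proof (induction j rule: int_ge_induct)
    case (step j)
    then show ?case using \<open>\<forall>i. \<nu> i \<le> \<nu> (i - 1)\<close>[rule_format, of "j + 1"] by simp
  qed simp
  then show "antimono \<nu>" by (rule antimonoI)
qed (simp add: antimonoD)

lemma cell_eq_iff: "cell d L i j = cell d L i' j' \<longleftrightarrow> (\<exists>k. i' = i - k * int d \<and> j' = j + k * int L)"
proof
  assume "cell d L i j = cell d L i' j'"
  moreover have "(i', j') \<in> cell d L i' j'" unfolding cell_def by (auto intro: exI[of _ 0])
  ultimately have "(i', j') \<in> cell d L i j" by simp
  then show "\<exists>k. i' = i - k * int d \<and> j' = j + k * int L" unfolding cell_def by auto
next
  assume "\<exists>k. i' = i - k * int d \<and> j' = j + k * int L"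
  then obtain k where k: "i' = i - k * int d" "j' = j + k * int L" by blast
  have "(i - m * int d, j + m * int L) = (i' - (m - k) * int d, j' + (m - k) * int L)" for m
    by (simp add: k algebra_simps)
  moreover have "(i' - m * int d, j' + m * int L) = (i - (m + k) * int d, j + (m + k) * int L)" for m
    by (simp add: k algebra_simps)
  ultimately show "cell d L i j = cell d L i' j'"
    unfolding cell_def by blast
qed

lemma cell_shift: "cell d L (i - k * int d) (j + k * int L) = cell d L i j"
  unfolding cell_eq_iff by (rule exI[of _ "-k"]) simp

lemma cell_shift_period: "cell d L (i + int d) (j - int L) = cell d L i j"
  using cell_shift[of d L i "-1" j] by simp

lemma shape_shift:
  assumes "\<nu> \<in> cylindric_shapes d L"
  shows "\<nu> (i - k * int d) = \<nu> i + k * int L"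
proof -
  have per: "\<nu> i = \<nu> (i + int d) + int L" for i
    using assms unfolding cylindric_shapes_def by blast
  have nat: "\<nu> (i - int k * int d) = \<nu> i + int k * int L" for i k
  proof (induction k arbitrary: i)
    case (Suc k)
    show ?case
      using Suc.IH[of i] per[of "i - int (Suc k) * int d"] by (simp add: algebra_simps)
  qed simp
  show ?thesis
  proof (cases "k \<ge> 0")
    case True
    then show ?thesis using nat[of i "nat k"] by (simp only: nat_0_le)
  next
    case False
    then have "int (nat (- k)) = - k" by simp
    then show ?thesis using nat[of "i - k * int d" "nat (- k)"] by (simp add: algebra_simps)
  qed
qed

lemma shape_antimono:
  assumes "\<nu> \<in> cylindric_shapes d L" "i \<le> j"
  shows "\<nu> j \<le> \<nu> i"
  using assms unfolding cylindric_shapes_def by (blast dest: antimonoD)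

lemma cell_in_young_iff:
  assumes "\<nu> \<in> cylindric_shapes d L"
  shows "cell d L i j \<in> young d L \<nu> \<longleftrightarrow> j \<le> \<nu> i"
  using shape_shift[OF assms] by (fastforce simp: young_def cell_eq_iff)

lemma cell_in_skew_iff:
  assumes "\<nu> \<in> cylindric_shapes d L" "\<alpha> \<in> cylindric_shapes d L"
  shows "cell d L i j \<in> skew_young d L \<nu> \<alpha> \<longleftrightarrow> \<alpha> i < j \<and> j \<le> \<nu> i"
  using assms by (auto simp: skew_young_def cell_in_young_iff)

lemma skew_young_cases:
  assumes "c \<in> skew_young d L \<nu> \<alpha>"
  obtains i j where "c = cell d L i j"
  using assms by (auto simp: skew_young_def young_def)

text \<open>
  The rows \<open>1, \<dots>, d\<close> serve as representatives of all rows, to count cells and to name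
  the steps of the simplex graph.
\<close>

lemma representative_row:
  assumes "d \<ge> 1"
  obtains k where "1 \<le> i - k * int d" "i - k * int d \<le> int d"
proof -
  have "1 \<le> i - ((i - 1) div int d) * int d" "i - ((i - 1) div int d) * int d \<le> int d"
    using minus_div_mult_eq_mod[of "i - 1" "int d"] pos_mod_bound[of "int d" "i - 1"]
      pos_mod_sign[of "int d" "i - 1"] assms by linarith+
  then show ?thesis by (rule that)
qed

lemma representative_unique:
  assumes "(1::int) \<le> i" "i \<le> int d" "1 \<le> i'" "i' \<le> int d" "int d dvd i - i'"
  shows "i = i'"
proof (rule ccontr)
  assume "i \<noteq> i'"
  then have "int d \<le> \<bar>i - i'\<bar>" using dvd_imp_le_int[OF _ assms(5)] by simp
  then show False using assms(1-4) by simp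
qed

text \<open>
  This makes the size condition on tableaux a consequence of the bijectivity of the
  filling, both for chains of shapes and for conjugates.
\<close>

lemma card_skew_young:
  assumes "d \<ge> 1" "\<nu> \<in> cylindric_shapes d L" "\<alpha> \<in> cylindric_shapes d L" "\<alpha> \<le> \<nu>"
  shows "int (card (skew_young d L \<nu> \<alpha>)) = skew_size d \<nu> \<alpha>"
proof -
  let ?S = "SIGMA i : {1..int d}. {\<alpha> i<..\<nu> i}"
  have "bij_betw (\<lambda>(i, j). cell d L i j) ?S (skew_young d L \<nu> \<alpha>)"
    unfolding bij_betw_def
  proof
    have "(i, j) = (i', j')"
      if "(i, j) \<in> ?S" "(i', j') \<in> ?S" and eq: "cell d L i j = cell d L i' j'" for i j i' j'
    proof -
      obtain k where k: "i' = i - k * int d" "j' = j + k * int L" using eq cell_eq_iff by blast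
      then have "i = i'" using that representative_unique[of i d i'] by simp
      then show ?thesis using k assms(1) by simp
    qed
    then show "inj_on (\<lambda>(i, j). cell d L i j) ?S" by (auto simp: inj_on_def)
    show "(\<lambda>(i, j). cell d L i j) ` ?S = skew_young d L \<nu> \<alpha>"
    proof
      show "(\<lambda>(i, j). cell d L i j) ` ?S \<subseteq> skew_young d L \<nu> \<alpha>"
        using assms by (auto simp: cell_in_skew_iff)
      show "skew_young d L \<nu> \<alpha> \<subseteq> (\<lambda>(i, j). cell d L i j) ` ?S"
      proof
        fix c assume c: "c \<in> skew_young d L \<nu> \<alpha>"
        then obtain i j where ij: "c = cell d L i j" by (rule skew_young_cases)
        obtain k where k: "1 \<le> i - k * int d" "i - k * int d \<le> int d"
          using representative_row[OF assms(1)] .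
        have eq: "c = cell d L (i - k * int d) (j + k * int L)" by (simp add: ij cell_shift)
        then show "c \<in> (\<lambda>(i, j). cell d L i j) ` ?S"
          using c k assms by (auto simp: cell_in_skew_iff
              intro!: image_eqI[of _ _ "(i - k * int d, j + k * int L)"])
      qed
    qed
  qed
  then have "card (skew_young d L \<nu> \<alpha>) = card ?S" by (simp add: bij_betw_same_card)
  also have "\<dots> = (\<Sum>i = 1..int d. nat (\<nu> i - \<alpha> i))" by simp
  also have "int \<dots> = skew_size d \<nu> \<alpha>"
    using assms(4) by (simp add: skew_size_def le_fun_def)
  finally show ?thesis .
qed


section \<open>The graph of cylindric shapes\<close>

text \<open>
  This graph is the common source of the coverings to the simplex and to the exclusion
  process. Adding a cell in row \<open>i\<close> lengthens all rows congruent to \<open>i\<close>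
  modulo \<open>d\<close>, since these rows represent the same row of the cylinder.
\<close>

definition add_cell :: "nat \<Rightarrow> int \<Rightarrow> (int \<Rightarrow> int) \<Rightarrow> int \<Rightarrow> int" where
  "add_cell d i \<nu> m = \<nu> m + of_bool (int d dvd m - i)"

definition shape_graph ::
  "nat \<Rightarrow> nat \<Rightarrow> (int \<Rightarrow> int, (int \<Rightarrow> int) \<times> (int \<Rightarrow> int)) pre_digraph" where
  "shape_graph d L = \<lparr>
     verts = cylindric_shapes d L,
     arcs = {(\<nu>, \<mu>). \<nu> \<in> cylindric_shapes d L \<and> \<mu> \<in> cylindric_shapes d L \<and>
       (\<exists>i. \<mu> = add_cell d i \<nu>)},
     tail = fst, head = snd\<rparr>"

lemma dvd_diff_swap: "(k::int) dvd a - b \<longleftrightarrow> k dvd b - a"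
  by (metis dvd_minus_iff minus_diff_eq)

lemma add_cell_cong:
  assumes "int d dvd i - i'"
  shows "add_cell d i = add_cell d i'"
proof -
  have "int d dvd m - i \<longleftrightarrow> int d dvd m - i'" for m
    using dvd_add_left_iff[OF assms, of "m - i"] by simp
  then show ?thesis by (simp add: add_cell_def fun_eq_iff)
qed

text \<open>
  For \<open>d = 1\<close> the row above is row \<open>i\<close> itself, lengthened by \<open>L\<close>, so a cell can always be
  added, because \<open>L\<close> is positive.
\<close>

lemma add_cell_in_shapes_iff:
  assumes "d \<ge> 1" "L \<ge> 1" and \<nu>: "\<nu> \<in> cylindric_shapes d L"
  shows "add_cell d i \<nu> \<in> cylindric_shapes d L \<longleftrightarrow> \<nu> i < \<nu> (i - 1)"
proof
  assume *: "add_cell d i \<nu> \<in> cylindric_shapes d L"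
  show "\<nu> i < \<nu> (i - 1)"
  proof (cases "d = 1")
    case True
    then show ?thesis using shape_shift[OF \<nu>, of i 1] assms(2) by simp
  next
    case False
    then have "\<not> int d dvd - 1" using assms(1) by (simp add: nat_dvd_1_iff_1)
    then show ?thesis
      using shape_antimono[OF *, of "i - 1" i] by (simp add: add_cell_def)
  qed
next
  assume less: "\<nu> i < \<nu> (i - 1)"
  have "add_cell d i \<nu> m \<le> add_cell d i \<nu> (m - 1)" for m
  proof (cases "int d dvd m - i")
    case True
    then obtain k where "m - i = int d * k" by (rule dvdE)
    then have m: "m = i - (- k) * int d" "m - 1 = (i - 1) - (- k) * int d" by (simp_all add: algebra_simps)
    have "\<nu> m < \<nu> (m - 1)"
      using less unfolding m(2) shape_shift[OF \<nu>] unfolding m(1) shape_shift[OF \<nu>] by simp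
    then show ?thesis by (simp add: add_cell_def)
  next
    case False
    then show ?thesis using shape_antimono[OF \<nu>, of "m - 1" m] by (simp add: add_cell_def)
  qed
  moreover have "add_cell d i \<nu> m = add_cell d i \<nu> (m + int d) + int L" for m
  proof -
    have "m + int d - i = m - i + int d" by simp
    then have "int d dvd m + int d - i \<longleftrightarrow> int d dvd m - i"
      by (metis dvd_add_left_iff dvd_refl)
    moreover have "\<nu> m = \<nu> (m + int d) + int L"
      using \<nu> unfolding cylindric_shapes_def by blast
    ultimately show ?thesis by (simp add: add_cell_def)
  qed
  ultimately show "add_cell d i \<nu> \<in> cylindric_shapes d L"
    unfolding cylindric_shapes_def antimono_int_iff by blast
qed

lemma shape_graph_arc_iff:
  assumes "d \<ge> 1" "L \<ge> 1" "\<nu> \<in> cylindric_shapes d L"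
  shows "(\<nu>, \<mu>) \<in> arcs (shape_graph d L) \<longleftrightarrow> (\<exists>i. \<nu> i < \<nu> (i - 1) \<and> \<mu> = add_cell d i \<nu>)"
  using assms add_cell_in_shapes_iff[OF assms] by (auto simp: shape_graph_def)

lemma skew_young_add_cell:
  assumes "\<nu> \<in> cylindric_shapes d L" "add_cell d i \<nu> \<in> cylindric_shapes d L"
  shows "skew_young d L (add_cell d i \<nu>) \<nu> = {cell d L i (\<nu> i + 1)}"
proof -
  have *: "cell d L m j \<in> skew_young d L (add_cell d i \<nu>) \<nu> \<longleftrightarrow> cell d L m j = cell d L i (\<nu> i + 1)"
    (is "?l \<longleftrightarrow> ?r") for m j
  proof -
    have "?l \<longleftrightarrow> int d dvd m - i \<and> j = \<nu> m + 1"
      using assms by (auto simp: cell_in_skew_iff add_cell_def)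
    also have "\<dots> \<longleftrightarrow> (\<exists>k. i = m - k * int d \<and> j = \<nu> m + 1)"
      by (auto simp: dvd_def algebra_simps)
    also have "\<dots> \<longleftrightarrow> ?r"
      unfolding cell_eq_iff
      by (intro ex_cong1 conj_cong refl) (use shape_shift[OF assms(1), of m] in auto)
    finally show ?thesis .
  qed
  show ?thesis
  proof (intro set_eqI)
    fix c
    show "c \<in> skew_young d L (add_cell d i \<nu>) \<nu> \<longleftrightarrow> c \<in> {cell d L i (\<nu> i + 1)}"
      by (metis * skew_young_cases singleton_iff)
  qed
qed


section \<open>Tableaux as walks in the graph of shapes\<close>

lemma down_closed_int_set:
  fixes S :: "int set"
  assumes "finite S" "\<And>j. j \<in> S \<Longrightarrow> a < j" "\<And>i j. j \<in> S \<Longrightarrow> a < i \<Longrightarrow> i \<le> j \<Longrightarrow> i \<in> S"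
  shows "S = {a<..a + int (card S)}"
proof (cases "S = {}")
  case False
  have "S = {a<..Max S}"
  proof
    show "S \<subseteq> {a<..Max S}" using assms(1,2) by auto
    show "{a<..Max S} \<subseteq> S" using assms(3)[OF Max_in[OF assms(1) False]] by auto
  qed
  moreover from this have "card S = nat (Max S - a)" by (metis card_greaterThanAtMost_int)
  moreover have "a < Max S" using assms(2) Max_in[OF assms(1) False] by blast
  ultimately show ?thesis by simp
qed simp

text \<open>The properties of a fixed tableau \<open>(\<nu>, T)\<close>, phrased by rows instead of cells.\<close>

locale tableau =
  fixes d L n :: nat and \<alpha> \<nu> :: "int \<Rightarrow> int" and T :: "cell \<Rightarrow> nat"
  assumes pos: "d \<ge> 1" "L \<ge> 1" and inner: "\<alpha> \<in> cylindric_shapes d L"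
    and tableau: "(\<nu>, T) \<in> SCT d L n \<alpha>"
begin

lemma outer: "\<nu> \<in> cylindric_shapes d L" and inner_le_outer: "\<alpha> i \<le> \<nu> i"
  and entries_bij: "bij_betw T (skew_young d L \<nu> \<alpha>) {1..n}"
  and filling_extensional: "T \<in> extensional (skew_young d L \<nu> \<alpha>)"
  using tableau by (auto simp: SCT_def le_fun_def)

lemma row_less:
  assumes "\<alpha> i < j" "j < \<nu> i"
  shows "T (cell d L i j) < T (cell d L i (j + 1))"
  using tableau assms by (simp add: SCT_def cell_in_skew_iff[OF outer inner])

lemma column_less:
  assumes "\<alpha> (i - 1) < j" "j \<le> \<nu> i"
  shows "T (cell d L (i - 1) j) < T (cell d L i j)"
proof -
  have "\<alpha> i \<le> \<alpha> (i - 1)" "\<nu> i \<le> \<nu> (i - 1)"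
    using shape_antimono[OF inner, of "i - 1" i] shape_antimono[OF outer, of "i - 1" i] by simp_all
  then have "cell d L (i - 1) j \<in> skew_young d L \<nu> \<alpha>" "cell d L (i - 1 + 1) j \<in> skew_young d L \<nu> \<alpha>"
    using assms by (auto simp: cell_in_skew_iff[OF outer inner])
  then have "T (cell d L (i - 1) j) < T (cell d L (i - 1 + 1) j)"
    using tableau unfolding SCT_def by blast
  then show ?thesis by simp
qed

lemma row_le:
  assumes "\<alpha> i < j" "j \<le> j'" "j' \<le> \<nu> i"
  shows "T (cell d L i j) \<le> T (cell d L i j')"
  using assms(2,3)
proof (induction j' rule: int_ge_induct)
  case (step j')
  then show ?case using row_less[of i j'] assms(1) by simp
qed simp

lemma entry_in_range:
  assumes "\<alpha> i < j" "j \<le> \<nu> i"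
  shows "T (cell d L i j) \<in> {1..n}"
  using bij_betw_imp_surj_on[OF entries_bij] assms cell_in_skew_iff[OF outer inner] by blast

abbreviation shape_at :: "nat \<Rightarrow> int \<Rightarrow> int" where
  "shape_at \<equiv> stage d L \<alpha> (\<nu>, T)"

text \<open>
  Since entries increase along rows, the cells with entry at most \<open>k\<close> form an initial
  segment of each row of the skew diagram, so counting them locates the end of the row.
\<close>

lemma le_stage_iff: "j \<le> shape_at k i \<longleftrightarrow> j \<le> \<alpha> i \<or> (j \<le> \<nu> i \<and> T (cell d L i j) \<le> k)"
proof -
  let ?S = "{j. \<alpha> i < j \<and> j \<le> \<nu> i \<and> T (cell d L i j) \<le> k}"
  have "?S \<subseteq> {\<alpha> i<..\<nu> i}" by auto
  then have "finite ?S" by (rule finite_subset) simp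
  then have "?S = {\<alpha> i<..\<alpha> i + int (card ?S)}"
    by (rule down_closed_int_set) (use row_le in \<open>fastforce+\<close>)
  also have "\<dots> = {\<alpha> i<..shape_at k i}" by (simp add: stage_def)
  finally have "j \<in> ?S \<longleftrightarrow> \<alpha> i < j \<and> j \<le> shape_at k i" by simp
  moreover have "\<alpha> i \<le> shape_at k i" by (simp add: stage_def)
  ultimately show ?thesis by auto
qed

lemma stage_in_shapes: "shape_at k \<in> cylindric_shapes d L"
proof -
  have "shape_at k i \<le> shape_at k (i - 1)" for i
  proof -
    let ?j = "shape_at k i"
    have "?j \<le> \<alpha> i \<or> (?j \<le> \<nu> i \<and> T (cell d L i ?j) \<le> k)"
      using le_stage_iff by blast
    then have "?j \<le> \<alpha> (i - 1) \<or> (?j \<le> \<nu> (i - 1) \<and> T (cell d L (i - 1) ?j) \<le> k)"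
      using shape_antimono[OF inner, of "i - 1" i] shape_antimono[OF outer, of "i - 1" i]
        column_less[of i ?j] by fastforce
    then show ?thesis using le_stage_iff by blast
  qed
  moreover have "shape_at k i = shape_at k (i + int d) + int L" for i
  proof -
    have "j \<le> shape_at k i \<longleftrightarrow> j \<le> shape_at k (i + int d) + int L" for j
    proof -
      have "\<alpha> (i + int d) = \<alpha> i - int L" "\<nu> (i + int d) = \<nu> i - int L"
        using shape_shift[OF inner, of i "-1"] shape_shift[OF outer, of i "-1"] by simp_all
      then show ?thesis
        using le_stage_iff[of j k i] le_stage_iff[of "j - int L" k "i + int d"]
          cell_shift_period[of d L i j] by auto
    qed
    then show ?thesis by (metis order_refl order_antisym)
  qed
  ultimately show ?thesis unfolding cylindric_shapes_def antimono_int_iff by blast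
qed

lemma stage_0: "shape_at 0 = \<alpha>"
proof (rule ext, rule int_eqI)
  fix i j
  show "j \<le> shape_at 0 i \<longleftrightarrow> j \<le> \<alpha> i"
    using entry_in_range[of i j] by (cases "\<alpha> i < j") (auto simp: le_stage_iff)
qed

lemma stage_last: "shape_at n = \<nu>"
proof (rule ext, rule int_eqI)
  fix i j
  show "j \<le> shape_at n i \<longleftrightarrow> j \<le> \<nu> i"
    using entry_in_range[of i j] inner_le_outer[of i]
    by (cases "\<alpha> i < j") (auto simp: le_stage_iff)
qed

text \<open>
  The cell with entry \<open>k + 1\<close> has one representative in each row congruent to its row
  modulo \<open>d\<close>, and none elsewhere.
\<close>

lemma stage_Suc:
  assumes "k < n"
  obtains i where "shape_at (Suc k) = add_cell d i (shape_at k)"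
proof -
  have "Suc k \<in> T ` skew_young d L \<nu> \<alpha>"
    using bij_betw_imp_surj_on[OF entries_bij] assms by simp
  then obtain c where c: "c \<in> skew_young d L \<nu> \<alpha>" "T c = Suc k" by auto
  then obtain i0 j0 where c_eq: "c = cell d L i0 j0" by (auto elim: skew_young_cases)
  have "shape_at (Suc k) m = add_cell d i0 (shape_at k) m" for m
  proof -
    let ?S = "\<lambda>P. {j. \<alpha> m < j \<and> j \<le> \<nu> m \<and> P (T (cell d L m j))}"
    have fin: "finite (?S P)" for P by (rule finite_subset[of _ "{\<alpha> m<..\<nu> m}"]) auto
    have "?S (\<lambda>e. e \<le> Suc k) = ?S (\<lambda>e. e \<le> k) \<union> ?S (\<lambda>e. e = Suc k)" by auto
    then have "card (?S (\<lambda>e. e \<le> Suc k)) = card (?S (\<lambda>e. e \<le> k)) + card (?S (\<lambda>e. e = Suc k))"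
      using card_Un_disjoint[OF fin fin, of "\<lambda>e. e \<le> k" "\<lambda>e. e = Suc k"] by fastforce
    moreover have "card (?S (\<lambda>e. e = Suc k)) = of_bool (int d dvd m - i0)"
    proof -
      have mem: "j \<in> ?S (\<lambda>e. e = Suc k) \<longleftrightarrow> cell d L m j = c" for j
        using c inj_onD[OF bij_betw_imp_inj_on[OF entries_bij], of "cell d L m j" c]
          cell_in_skew_iff[OF outer inner, of m j] by auto
      show ?thesis
      proof (cases "int d dvd m - i0")
        case True
        then obtain q where "m - i0 = int d * q" by (rule dvdE)
        then have q: "i0 = m - q * int d" by (simp add: algebra_simps)
        have "cell d L m j = c \<longleftrightarrow> j = j0 - q * int L" for j
          using pos unfolding c_eq cell_eq_iff q by auto
        then have "?S (\<lambda>e. e = Suc k) = {j0 - q * int L}" using mem by blast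
        then show ?thesis using True by simp
      next
        case False
        then have "cell d L m j \<noteq> c" for j
          unfolding c_eq cell_eq_iff by auto
        then have "?S (\<lambda>e. e = Suc k) = {}" using mem by blast
        then show ?thesis using False by (simp only: card.empty of_bool_eq)
      qed
    qed
    ultimately show ?thesis by (simp add: stage_def add_cell_def)
  qed
  then show ?thesis using that by blast
qed

lemma stages_walk: "path_through shape_at n \<in> walks_from (shape_graph d L) n \<alpha>"
proof -
  have "(shape_at k, shape_at (Suc k)) \<in> arcs (shape_graph d L)" if "k < n" for k
    using stage_in_shapes stage_Suc[OF that] by (auto simp: shape_graph_def)
  then show ?thesis
    using stage_0 inner by (subst walks_from_simple) (auto simp: shape_graph_def)
qed

end

text \<open>The entry of a cell is the first \<open>k\<close> for which the \<open>k\<close>th shape contains the cell.\<close>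

lemma stages_determine_tableau:
  assumes "tableau d L n \<alpha> \<nu> T" "tableau d L n \<alpha> \<nu>' T'"
    and eq: "\<And>k. k \<le> n \<Longrightarrow> stage d L \<alpha> (\<nu>, T) k = stage d L \<alpha> (\<nu>', T') k"
  shows "(\<nu>, T) = (\<nu>', T')"
proof -
  interpret T: tableau d L n \<alpha> \<nu> T by fact
  interpret T': tableau d L n \<alpha> \<nu>' T' by fact
  have \<nu>: "\<nu> = \<nu>'" using eq[of n] T.stage_last T'.stage_last by simp
  have "T c = T' c" if "c \<in> skew_young d L \<nu> \<alpha>" for c
  proof -
    obtain i j where c: "c = cell d L i j" "\<alpha> i < j" "j \<le> \<nu> i"
      using \<open>c \<in> skew_young d L \<nu> \<alpha>\<close> skew_young_cases cell_in_skew_iff[OF T.outer T.inner] by metis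
    have "T c \<le> k \<longleftrightarrow> T' c \<le> k" if "k \<le> n" for k
      using T.le_stage_iff[of j k i] T'.le_stage_iff[of j k i] eq[OF that] c \<nu> by simp
    moreover have "T c \<le> n" "T' c \<le> n"
      using T.entry_in_range[of i j] T'.entry_in_range[of i j] c \<nu> by auto
    ultimately show ?thesis by (metis order_refl order_antisym)
  qed
  then have "T = T'" using T.filling_extensional T'.filling_extensional \<nu>
    by (intro extensionalityI[of T "skew_young d L \<nu> \<alpha>" T']) auto
  then show ?thesis using \<nu> by simp
qed

text \<open>
  Conversely, a chain of shapes is filled by entering in each cell the time at which
  the cell appears.
\<close>

lemma chain_of_shapes_tableau:
  assumes pos: "d \<ge> 1" "L \<ge> 1" and "f 0 = \<alpha>"
    and shapes: "\<And>k. k \<le> n \<Longrightarrow> f k \<in> cylindric_shapes d L"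
    and step: "\<And>k. k < n \<Longrightarrow> \<exists>i. f (Suc k) = add_cell d i (f k)"
  shows "\<exists>T. (f n, T) \<in> SCT d L n \<alpha> \<and> (\<forall>k\<le>n. stage d L \<alpha> (f n, T) k = f k)"
proof -
  let ?Y = "skew_young d L (f n) \<alpha>"
  define T where "T = restrict (\<lambda>c. LEAST k. c \<in> young d L (f k)) ?Y"
  have inner: "\<alpha> \<in> cylindric_shapes d L" and outer: "f n \<in> cylindric_shapes d L"
    using shapes[of 0] shapes[of n] \<open>f 0 = \<alpha>\<close> by auto
  have le: "f k m \<le> f k' m" if "k \<le> k'" "k' \<le> n" for k k' m
    using that
  proof (induction k' rule: dec_induct)
    case (step k')
    then show ?case using assms(5)[of k'] by (fastforce simp: add_cell_def)
  qed simp
  have mem: "cell d L i j \<in> ?Y \<longleftrightarrow> \<alpha> i < j \<and> j \<le> f n i" for i j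
    by (rule cell_in_skew_iff[OF outer inner])
  have T_le_iff: "T (cell d L i j) \<le> k \<longleftrightarrow> j \<le> f k i" if "cell d L i j \<in> ?Y" "k \<le> n" for i j k
  proof -
    let ?P = "\<lambda>k. cell d L i j \<in> young d L (f k)"
    have "?P n" using that by (simp add: skew_young_def)
    then have least: "?P (Least ?P)" "Least ?P \<le> n" by (auto intro: LeastI Least_le)
    have "Least ?P \<le> k \<longleftrightarrow> ?P k"
    proof
      assume *: "Least ?P \<le> k"
      have "j \<le> f (Least ?P) i" using least cell_in_young_iff shapes by blast
      then have "j \<le> f k i" using le[OF * that(2), of i] by simp
      then show "?P k" using cell_in_young_iff shapes that(2) by blast
    qed (rule Least_le)
    then show ?thesis
      using that cell_in_young_iff[OF shapes[OF that(2)]] by (simp add: T_def)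
  qed
  have range: "T c \<in> {1..n}" if "c \<in> ?Y" for c
  proof -
    obtain i j where c: "c = cell d L i j" using skew_young_cases \<open>c \<in> ?Y\<close> .
    have "T c \<le> n" using T_le_iff[of i j n] that c mem by auto
    moreover have "\<not> T c \<le> 0" using T_le_iff[of i j 0] that c mem \<open>f 0 = \<alpha>\<close> by auto
    ultimately show ?thesis by simp
  qed
  have T_eq_iff: "T c = Suc k \<longleftrightarrow> c \<in> skew_young d L (f (Suc k)) (f k)" if "c \<in> ?Y" "k < n" for c k
  proof -
    obtain i j where c: "c = cell d L i j" using skew_young_cases \<open>c \<in> ?Y\<close> .
    have "c \<in> skew_young d L (f (Suc k)) (f k) \<longleftrightarrow> f k i < j \<and> j \<le> f (Suc k) i"
      unfolding c using shapes that by (intro cell_in_skew_iff) auto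
    then show ?thesis
      using T_le_iff[of i j k] T_le_iff[of i j "Suc k"] that unfolding c by auto
  qed
  have entry: "\<exists>!c. c \<in> ?Y \<and> T c = Suc k" if "k < n" for k
  proof -
    obtain i where i: "f (Suc k) = add_cell d i (f k)" using step \<open>k < n\<close> by blast
    have fk: "f k \<in> cylindric_shapes d L" "f (Suc k) \<in> cylindric_shapes d L"
      using shapes that by auto
    have eq: "skew_young d L (f (Suc k)) (f k) = {cell d L i (f k i + 1)}"
      using skew_young_add_cell fk unfolding i by blast
    have "\<alpha> i < f k i + 1" using le[of 0 k i] that \<open>f 0 = \<alpha>\<close> by simp
    moreover have "f k i + 1 \<le> f n i" using le[of "Suc k" n i] that by (simp add: i add_cell_def)
    ultimately have Y: "cell d L i (f k i + 1) \<in> ?Y" by (simp add: mem)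
    have "c \<in> ?Y \<and> T c = Suc k \<longleftrightarrow> c = cell d L i (f k i + 1)" for c
      using T_eq_iff[OF _ that, of c] Y unfolding eq by auto
    then show ?thesis by simp
  qed
  have inj: "inj_on T ?Y"
  proof (rule inj_onI)
    fix c c' assume cc: "c \<in> ?Y" "c' \<in> ?Y" "T c = T c'"
    then have "T c = Suc (T c - 1)" "T c - 1 < n" using range[of c] by auto
    then obtain k where "T c = Suc k" "k < n" by blast
    then show "c = c'" using entry[of k] cc by auto
  qed
  have "T ` ?Y = {1..n}"
  proof
    show "{1..n} \<subseteq> T ` ?Y"
    proof
      fix e assume "e \<in> {1..n}"
      then obtain k where "e = Suc k" "k < n" by (cases e) auto
      moreover obtain c where "c \<in> ?Y" "T c = Suc k" using entry \<open>k < n\<close> by blast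
      ultimately show "e \<in> T ` ?Y" by (metis imageI)
    qed
  qed (use range in auto)
  then have bij: "bij_betw T ?Y {1..n}" using inj by (simp add: bij_betw_def)
  have ge: "\<alpha> \<le> f n" using le[of 0 n] \<open>f 0 = \<alpha>\<close> by (simp add: le_fun_def)
  have size: "skew_size d (f n) \<alpha> = int n"
    using card_skew_young[OF pos(1) outer inner ge] bij_betw_same_card[OF bij] by simp
  \<comment> \<open>A cell is contained in every shape that contains its right or lower neighbour, and
    distinct cells do not appear at the same time.\<close>
  have less: "T c < T c'" if "c = cell d L i j" "c' = cell d L i' j'" "c \<in> ?Y" "c' \<in> ?Y" "c \<noteq> c'"
    "i \<le> i'" "j \<le> j'" for c c' i j i' j'
  proof -
    have "T c' \<le> n" using range that by fastforce
    then have "j' \<le> f (T c') i'" using T_le_iff[of i' j' "T c'"] that by auto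
    moreover have "f (T c') i' \<le> f (T c') i"
      using shape_antimono shapes \<open>T c' \<le> n\<close> that by blast
    ultimately have "T c \<le> T c'" using T_le_iff[of i j "T c'"] that \<open>T c' \<le> n\<close> by auto
    moreover have "T c \<noteq> T c'" using inj that by (auto dest: inj_onD)
    ultimately show ?thesis by simp
  qed
  have ne: "cell d L i j \<noteq> cell d L i (j + 1)" "cell d L i j \<noteq> cell d L (i + 1) j" for i j
    using pos by (auto simp: cell_eq_iff)
  have "(f n, T) \<in> SCT d L n \<alpha>"
    unfolding SCT_def using outer ge size bij less[OF refl refl _ _ ne(1)] less[OF refl refl _ _ ne(2)]
    by (auto simp: T_def)
  moreover have "stage d L \<alpha> (f n, T) k = f k" if "k \<le> n" for k
  proof
    fix i
    have "{j. \<alpha> i < j \<and> j \<le> f n i \<and> T (cell d L i j) \<le> k} = {\<alpha> i<..f k i}"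
      using T_le_iff[OF _ that] mem le[OF that order_refl, of i] by (auto intro: order_trans)
    moreover have "\<alpha> i \<le> f k i" using le[of 0 k i] that \<open>f 0 = \<alpha>\<close> by simp
    ultimately show "stage d L \<alpha> (f n, T) k i = f k i" by (simp add: stage_def)
  qed
  ultimately show ?thesis by blast
qed

lemma tableaux_bij_betw_shape_walks:
  assumes "d \<ge> 1" "L \<ge> 1" "\<alpha> \<in> cylindric_shapes d L"
  shows "bij_betw (\<lambda>T. path_through (stage d L \<alpha> T) n) (SCT d L n \<alpha>)
    (walks_from (shape_graph d L) n \<alpha>)"
proof -
  have tab: "tableau d L n \<alpha> \<nu> T" if "(\<nu>, T) \<in> SCT d L n \<alpha>" for \<nu> T
    using assms that by (simp add: tableau_def)
  have "inj_on (\<lambda>T. path_through (stage d L \<alpha> T) n) (SCT d L n \<alpha>)"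
  proof (rule inj_onI, clarify)
    fix \<nu> T \<nu>' T'
    assume T: "(\<nu>, T) \<in> SCT d L n \<alpha>" and T': "(\<nu>', T') \<in> SCT d L n \<alpha>"
      and eq: "path_through (stage d L \<alpha> (\<nu>, T)) n = path_through (stage d L \<alpha> (\<nu>', T')) n"
    have "stage d L \<alpha> (\<nu>, T) 0 = stage d L \<alpha> (\<nu>', T') 0"
      using tableau.stage_0[OF tab[OF T]] tableau.stage_0[OF tab[OF T']] by simp
    then have "(\<nu>, T) = (\<nu>', T')"
      using eq path_through_eq_iff
      by (intro stages_determine_tableau[OF tab[OF T] tab[OF T']]) blast
    then show "\<nu> = \<nu>' \<and> T = T'" by simp
  qed
  moreover have "(\<lambda>T. path_through (stage d L \<alpha> T) n) ` SCT d L n \<alpha> =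
      walks_from (shape_graph d L) n \<alpha>"
  proof
    show "(\<lambda>T. path_through (stage d L \<alpha> T) n) ` SCT d L n \<alpha> \<subseteq> walks_from (shape_graph d L) n \<alpha>"
      using tableau.stages_walk tab by auto
    show "walks_from (shape_graph d L) n \<alpha> \<subseteq> (\<lambda>T. path_through (stage d L \<alpha> T) n) ` SCT d L n \<alpha>"
    proof
      fix p assume "p \<in> walks_from (shape_graph d L) n \<alpha>"
      then obtain f where f: "f 0 = \<alpha>" "p = path_through f n"
        "\<And>k. k < n \<Longrightarrow> (f k, f (Suc k)) \<in> arcs (shape_graph d L)"
        using assms(3) by (subst (asm) walks_from_simple) (auto simp: shape_graph_def)
      have "f k \<in> cylindric_shapes d L" if "k \<le> n" for k
        using f(3)[of "k - 1"] f(1) assms(3) that by (cases k) (auto simp: shape_graph_def)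
      then obtain T where T: "(f n, T) \<in> SCT d L n \<alpha>" "\<forall>k\<le>n. stage d L \<alpha> (f n, T) k = f k"
        using chain_of_shapes_tableau[of d L f \<alpha> n] assms f by (auto simp: shape_graph_def)
      have "p = path_through (stage d L \<alpha> (f n, T)) n"
        using T(2) f(2) by (simp add: path_through_def)
      then show "p \<in> (\<lambda>T. path_through (stage d L \<alpha> T) n) ` SCT d L n \<alpha>"
        using T(1) by blast
    qed
  qed
  ultimately show ?thesis by (simp add: bij_betw_def)
qed


section \<open>From shapes to the simplex graph\<close>

lemma length_gaps [simp]: "length (gaps d \<nu>) = d"
  by (simp add: gaps_def)

lemma nth_gaps: "k < d \<Longrightarrow> gaps d \<nu> ! k = nat (\<nu> (int k) - \<nu> (int k + 1))"
  by (simp add: gaps_def add.commute)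

lemma int_nth_gaps:
  assumes "\<nu> \<in> cylindric_shapes d L" "k < d"
  shows "int (gaps d \<nu> ! k) = \<nu> (int k) - \<nu> (int k + 1)"
  using shape_antimono[OF assms(1), of "int k" "int k + 1"] assms(2) by (simp add: nth_gaps)

lemma gaps_in_simplex:
  assumes "\<nu> \<in> cylindric_shapes d L"
  shows "gaps d \<nu> \<in> simplex d L"
proof -
  have "int (sum_list (gaps d \<nu>)) = (\<Sum>k<d. int (gaps d \<nu> ! k))"
    by (simp add: sum_list_sum_nth lessThan_atLeast0)
  also have "\<dots> = (\<Sum>k<d. \<nu> (int k) - \<nu> (int (Suc k)))"
    by (rule sum.cong) (simp_all add: int_nth_gaps[OF assms] add.commute)
  also have "\<dots> = \<nu> 0 - \<nu> (int d)"
    using sum_lessThan_telescope'[of "\<lambda>k. \<nu> (int k)" d] by simp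
  also have "\<dots> = int L" using shape_shift[OF assms, of "int d" 1] by simp
  finally show ?thesis by (simp add: simplex_def)
qed

lemma shape_graph_arc_row:
  assumes "d \<ge> 1" "(\<nu>, \<mu>) \<in> arcs (shape_graph d L)"
  obtains r where "r < d" "\<mu> = add_cell d (int r + 1) \<nu>"
proof -
  obtain i where i: "\<mu> = add_cell d i \<nu>" using assms(2) by (auto simp: shape_graph_def)
  obtain k where k: "1 \<le> i - k * int d" "i - k * int d \<le> int d"
    using representative_row[OF assms(1)] .
  let ?r = "nat (i - k * int d - 1)"
  have "int d dvd i - (int ?r + 1)" using k by simp
  then have "\<mu> = add_cell d (int ?r + 1) \<nu>" using i add_cell_cong by metis
  moreover have "?r < d" using k by linarith
  ultimately show ?thesis by (rule that[rotated])
qed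

lemma dvd_diff_less_iff:
  assumes "a < N" "b < N"
  shows "int N dvd int a - int b \<longleftrightarrow> a = b"
  using assms by (metis mod_eq_dvd_iff mod_less of_nat_eq_iff zmod_int)

lemma gaps_add_cell:
  assumes "\<nu> \<in> cylindric_shapes d L" "add_cell d (int r + 1) \<nu> \<in> cylindric_shapes d L"
    and "r < d" "k < d"
  shows "int (gaps d (add_cell d (int r + 1) \<nu>) ! k) - int (gaps d \<nu> ! k) = simplex_step d r k"
proof -
  have "int d dvd int k - (int r + 1) \<longleftrightarrow> k = Suc r mod d"
  proof -
    have "int d dvd int k - (int r + 1) \<longleftrightarrow> int k mod int d = int (Suc r) mod int d"
      by (simp add: mod_eq_dvd_iff add.commute)
    also have "\<dots> \<longleftrightarrow> k mod d = Suc r mod d" by (metis of_nat_eq_iff zmod_int)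
    finally show ?thesis using assms(4) by simp
  qed
  moreover have "int d dvd int k + 1 - (int r + 1) \<longleftrightarrow> k = r"
    using dvd_diff_less_iff[OF assms(4,3)] by simp
  ultimately show ?thesis
    using assms by (auto simp: int_nth_gaps[OF assms(1)] int_nth_gaps[OF assms(2)] simplex_step_def
        unit_vec_def add_cell_def)
qed

lemma simplex_step_self: "r < d \<Longrightarrow> d \<noteq> 1 \<Longrightarrow> simplex_step d r r = - 1"
  by (auto simp: simplex_step_def unit_vec_def mod_Suc split: if_splits)

text \<open>
  The index of a step is where its coordinate is \<open>- 1\<close>. For \<open>d = 1\<close> the step is zero, but
  then there is only one index.
\<close>

lemma simplex_step_inj:
  assumes "r < d" "r' < d" "\<And>k. k < d \<Longrightarrow> simplex_step d r k = simplex_step d r' k"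
  shows "r = r'"
proof (cases "d = 1")
  case False
  then have "simplex_step d r' r = - 1" using assms simplex_step_self by metis
  then show ?thesis by (auto simp: simplex_step_def unit_vec_def split: if_splits)
qed (use assms in simp)

text \<open>
  A cell may be added in row \<open>i\<close> exactly when \<open>x\<^sub>i\<close> is positive, which is when the step
  \<open>s\<^sub>i\<close> stays in the simplex; for \<open>d = 1\<close> both are always possible.
\<close>

lemma gaps_covering:
  assumes "d \<ge> 1" "L \<ge> 1"
  shows "covering (shape_graph d L) (simplex_graph d L) (gaps d) (map_prod (gaps d) (gaps d))"
proof (rule coveringI_simple)
  fix \<nu> \<mu> assume \<nu>: "\<nu> \<in> verts (shape_graph d L)" and arc: "(\<nu>, \<mu>) \<in> arcs (shape_graph d L)"
  then have shapes: "\<nu> \<in> cylindric_shapes d L" "\<mu> \<in> cylindric_shapes d L"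
    by (auto simp: shape_graph_def)
  obtain r where r: "r < d" "\<mu> = add_cell d (int r + 1) \<nu>"
    using shape_graph_arc_row[OF assms(1) arc] .
  have step: "int (gaps d \<mu> ! k) - int (gaps d \<nu> ! k) = simplex_step d r k" if "k < d" for k
    using gaps_add_cell shapes r that by blast
  then show "(gaps d \<nu>, gaps d \<mu>) \<in> arcs (simplex_graph d L)"
    using gaps_in_simplex shapes r(1) by (auto simp: simplex_graph_def)
  fix \<mu>' assume arc': "(\<nu>, \<mu>') \<in> arcs (shape_graph d L)" and eq: "gaps d \<mu> = gaps d \<mu>'"
  then have shape': "\<mu>' \<in> cylindric_shapes d L" by (auto simp: shape_graph_def)
  obtain r' where r': "r' < d" "\<mu>' = add_cell d (int r' + 1) \<nu>"
    using shape_graph_arc_row[OF assms(1) arc'] .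
  have "int (gaps d \<mu>' ! k) - int (gaps d \<nu> ! k) = simplex_step d r' k" if "k < d" for k
    using gaps_add_cell shapes(1) shape' r' that by blast
  then have "r = r'" using step eq r(1) r'(1) simplex_step_inj by metis
  then show "\<mu> = \<mu>'" using r r' by simp
next
  fix \<nu> z assume "\<nu> \<in> verts (shape_graph d L)" and arc: "(gaps d \<nu>, z) \<in> arcs (simplex_graph d L)"
  then have \<nu>: "\<nu> \<in> cylindric_shapes d L" by (simp add: shape_graph_def)
  obtain r where r: "r < d" and z: "length z = d"
    "\<And>k. k < d \<Longrightarrow> int (z ! k) - int (gaps d \<nu> ! k) = simplex_step d r k"
    using arc by (auto simp: simplex_graph_def simplex_def)
  have "0 < int (gaps d \<nu> ! r)"
  proof (cases "d = 1")
    case True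
    then show ?thesis
      using gaps_in_simplex[OF \<nu>] assms(2) r by (auto simp: simplex_def length_Suc_conv)
  next
    case False
    then show ?thesis using z(2)[OF r] simplex_step_self[OF r] by simp
  qed
  then have less: "\<nu> (int r + 1) < \<nu> (int r + 1 - 1)" by (simp add: int_nth_gaps[OF \<nu> r])
  let ?\<mu> = "add_cell d (int r + 1) \<nu>"
  have \<mu>: "?\<mu> \<in> cylindric_shapes d L" using less add_cell_in_shapes_iff[OF assms \<nu>] by blast
  have "gaps d ?\<mu> = z"
  proof (rule nth_equalityI)
    fix k assume "k < length (gaps d ?\<mu>)"
    then show "gaps d ?\<mu> ! k = z ! k" using gaps_add_cell[OF \<nu> \<mu> r, of k] z(2)[of k] by simp
  qed (simp add: z)
  then show "\<exists>\<mu>. (\<nu>, \<mu>) \<in> arcs (shape_graph d L) \<and> gaps d \<mu> = z"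
    using less shape_graph_arc_iff[OF assms \<nu>] by blast
qed (auto simp: shape_graph_def simplex_graph_def gaps_in_simplex)


section \<open>From shapes to the exclusion process\<close>

text \<open>The relation \<open>hop\<close> with its site exposed: \<open>u\<close> and \<open>p\<close> determine \<open>v\<close>, and \<open>u\<close> and \<open>v\<close> determine \<open>p\<close>.\<close>

definition hop_at :: "bool list \<Rightarrow> nat \<Rightarrow> bool list \<Rightarrow> bool" where
  "hop_at u p v \<longleftrightarrow> length v = length u \<and> p < length u \<and>
     \<not> u ! p \<and> u ! (Suc p mod length u) \<and>
     (\<forall>t < length u. v ! t \<longleftrightarrow> t = p \<or> (u ! t \<and> t \<noteq> Suc p mod length u))"

lemma hop_iff_hop_at: "hop u v \<longleftrightarrow> (\<exists>p. hop_at u p v)"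
proof
  assume "hop u v"
  then obtain p where *: "length v = length u" "p < length u" "\<not> u ! p" "u ! (Suc p mod length u)"
    "v ! p" "\<not> v ! (Suc p mod length u)"
    "\<And>t. t < length u \<Longrightarrow> t \<noteq> p \<Longrightarrow> t \<noteq> Suc p mod length u \<Longrightarrow> u ! t = v ! t"
    unfolding hop_def by blast
  then have "hop_at u p v" unfolding hop_at_def by metis
  then show "\<exists>p. hop_at u p v" ..
next
  assume "\<exists>p. hop_at u p v"
  then obtain p where p: "hop_at u p v" ..
  then have "Suc p mod length u < length u" "Suc p mod length u \<noteq> p"
    by (auto simp: hop_at_def intro: mod_less_divisor)
  then show "hop u v" using p unfolding hop_def hop_at_def by metis
qed

lemma hop_at_result_unique: "hop_at u p v \<Longrightarrow> hop_at u p w \<Longrightarrow> v = w"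
  by (rule nth_equalityI) (auto simp: hop_at_def)

lemma hop_at_site_unique: "hop_at u p v \<Longrightarrow> hop_at u q v \<Longrightarrow> p = q"
  by (auto simp: hop_at_def)

text \<open>
  The predicate that \<open>shape_state\<close> evaluates at the sites \<open>1, \<dots>, d + L\<close>, on all integers,
  where it is periodic and needs no reduction modulo \<open>d + L\<close>.
\<close>

definition occupied :: "int \<Rightarrow> (int \<Rightarrow> int) \<Rightarrow> int \<Rightarrow> bool" where
  "occupied a \<nu> p \<longleftrightarrow> (\<exists>i. p = i + a - \<nu> i)"

lemma length_shape_state [simp]: "length (shape_state d L a \<nu>) = d + L"
  by (simp add: shape_state_def)

lemma nth_shape_state: "t < d + L \<Longrightarrow> shape_state d L a \<nu> ! t \<longleftrightarrow> occupied a \<nu> (int t + 1)"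
  by (simp add: shape_state_def occupied_def add.commute)

lemma particle_strict_mono:
  assumes "\<nu> \<in> cylindric_shapes d L" "i < j"
  shows "i - \<nu> i < j - \<nu> j"
  using shape_antimono[OF assms(1), of i j] assms(2) by simp

lemma particle_eq_iff:
  assumes "\<nu> \<in> cylindric_shapes d L"
  shows "i - \<nu> i = j - \<nu> j \<longleftrightarrow> i = j"
  using particle_strict_mono[OF assms, of i j] particle_strict_mono[OF assms, of j i]
  by (cases i j rule: linorder_cases) auto

text \<open>The sequence of particles is periodic: \<open>d\<close> particles span \<open>d + L\<close> sites.\<close>

lemma particle_cong_iff:
  assumes "\<nu> \<in> cylindric_shapes d L"
  shows "int (d + L) dvd (i - \<nu> i) - (j - \<nu> j) \<longleftrightarrow> int d dvd i - j"
proof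
  assume "int (d + L) dvd (i - \<nu> i) - (j - \<nu> j)"
  then obtain k where "(i - \<nu> i) - (j - \<nu> j) = int (d + L) * k" by (rule dvdE)
  then have "i - \<nu> i = (j - (- k) * int d) - \<nu> (j - (- k) * int d)"
    unfolding shape_shift[OF assms] by (simp add: algebra_simps)
  then have "i = j - (- k) * int d" unfolding particle_eq_iff[OF assms] .
  then show "int d dvd i - j" by simp
next
  assume "int d dvd i - j"
  then obtain k where "i - j = int d * k" by (rule dvdE)
  then have i: "i = j - (- k) * int d" by (simp add: algebra_simps)
  have "(i - \<nu> i) - (j - \<nu> j) = int (d + L) * k"
    unfolding i shape_shift[OF assms] by (simp add: algebra_simps)
  then show "int (d + L) dvd (i - \<nu> i) - (j - \<nu> j)" by simp
qed

lemma particle_lift: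
  assumes "\<nu> \<in> cylindric_shapes d L" "int (d + L) dvd p - (i + a - \<nu> i)"
  obtains j where "p = j + a - \<nu> j" "int d dvd j - i"
proof -
  obtain k where k: "p - (i + a - \<nu> i) = int (d + L) * k" using assms(2) by (rule dvdE)
  have "p = (i - (- k) * int d) + a - \<nu> (i - (- k) * int d)"
    unfolding shape_shift[OF assms(1)] using k by (simp add: algebra_simps)
  moreover have "int d dvd (i - (- k) * int d) - i" by simp
  ultimately show ?thesis by (rule that)
qed

lemma occupied_cong:
  assumes "\<nu> \<in> cylindric_shapes d L" "int (d + L) dvd p - q"
  shows "occupied a \<nu> p \<longleftrightarrow> occupied a \<nu> q"
proof -
  have "occupied a \<nu> p" if "occupied a \<nu> q" "int (d + L) dvd p - q" for p q
    using that particle_lift[OF assms(1)] unfolding occupied_def by metis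
  then show ?thesis using assms(2) dvd_diff_swap by metis
qed

text \<open>
  Reduction modulo \<open>d + L\<close> matches the particles \<open>1, \<dots>, d\<close> with the occupied sites of one
  period, whatever the origin \<open>a\<close>.
\<close>

lemma card_occupied:
  assumes "d \<ge> 1" "\<nu> \<in> cylindric_shapes d L"
  shows "card {t. t < d + L \<and> occupied a \<nu> (int t + 1)} = d"
proof -
  let ?N = "int (d + L)"
  let ?h = "\<lambda>i. nat ((i + a - \<nu> i - 1) mod ?N)"
  have N: "?N > 0" using assms(1) by simp
  have h: "int (?h i) = (i + a - \<nu> i - 1) mod ?N" for i using N by simp
  have h_dvd: "?N dvd int (?h i) + 1 - (i + a - \<nu> i)" for i
  proof -
    have "int (?h i) mod ?N = (i + a - \<nu> i - 1) mod ?N" by (simp only: h mod_mod_trivial)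
    moreover have "int (?h i) + 1 - (i + a - \<nu> i) = int (?h i) - (i + a - \<nu> i - 1)" by simp
    ultimately show ?thesis by (simp only: mod_eq_dvd_iff)
  qed
  have "bij_betw ?h {1..int d} {t. t < d + L \<and> occupied a \<nu> (int t + 1)}"
    unfolding bij_betw_def
  proof
    show "inj_on ?h {1..int d}"
    proof (rule inj_onI)
      fix i j assume ij: "i \<in> {1..int d}" "j \<in> {1..int d}" "?h i = ?h j"
      then have "(i + a - \<nu> i - 1) mod ?N = (j + a - \<nu> j - 1) mod ?N" using h by metis
      then have "?N dvd (i - \<nu> i) - (j - \<nu> j)" by (simp add: mod_eq_dvd_iff algebra_simps)
      then show "i = j" using ij representative_unique[of i d j] particle_cong_iff[OF assms(2)] by simp
    qed
    show "?h ` {1..int d} = {t. t < d + L \<and> occupied a \<nu> (int t + 1)}"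
    proof (intro equalityI subsetI)
      fix t assume "t \<in> ?h ` {1..int d}"
      then obtain i where i: "t = ?h i" by blast
      have "int t < ?N" unfolding i h using N by simp
      moreover have "occupied a \<nu> (int t + 1)"
        using occupied_cong[OF assms(2), OF h_dvd, of a i] i by (auto simp: occupied_def)
      ultimately show "t \<in> {t. t < d + L \<and> occupied a \<nu> (int t + 1)}" by simp
    next
      fix t assume "t \<in> {t. t < d + L \<and> occupied a \<nu> (int t + 1)}"
      then obtain i where t: "t < d + L" and i: "int t + 1 = i + a - \<nu> i" by (auto simp: occupied_def)
      obtain k where k: "1 \<le> i - k * int d" "i - k * int d \<le> int d"
        using representative_row[OF assms(1)] .
      let ?i = "i - k * int d"
      have "?N dvd (?i - \<nu> ?i) - (i - \<nu> i)" unfolding particle_cong_iff[OF assms(2)] by simp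
      then have "(?i + a - \<nu> ?i - 1) mod ?N = (i + a - \<nu> i - 1) mod ?N"
        by (simp add: mod_eq_dvd_iff algebra_simps)
      moreover have "i + a - \<nu> i - 1 = int t" using i by simp
      ultimately have "int (?h ?i) = int t mod ?N" using h by metis
      then have "t = ?h ?i" using t by simp
      then show "t \<in> ?h ` {1..int d}" using k by auto
    qed
  qed
  then show ?thesis using bij_betw_same_card by fastforce
qed

lemma count_list_True: "count_list u True = card {t. t < length u \<and> u ! t}"
  by (simp add: count_list_eq_length_filter length_filter_conv_card)

lemma shape_state_in_states:
  assumes "d \<ge> 1" "\<nu> \<in> cylindric_shapes d L"
  shows "shape_state d L a \<nu> \<in> states d L"
proof -
  have "{t. t < d + L \<and> shape_state d L a \<nu> ! t} = {t. t < d + L \<and> occupied a \<nu> (int t + 1)}"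
    using nth_shape_state by blast
  then show ?thesis using card_occupied[OF assms] by (simp add: states_def count_list_True)
qed

lemma occupied_add_cell:
  assumes "\<nu> \<in> cylindric_shapes d L"
  shows "occupied a (add_cell d i \<nu>) p \<longleftrightarrow>
    int (d + L) dvd p - (i + a - \<nu> i - 1) \<or>
    (occupied a \<nu> p \<and> \<not> int (d + L) dvd p - (i + a - \<nu> i))"
proof
  assume "occupied a (add_cell d i \<nu>) p"
  then obtain m where m: "p = m + a - \<nu> m - of_bool (int d dvd m - i)"
    by (auto simp: occupied_def add_cell_def)
  show "int (d + L) dvd p - (i + a - \<nu> i - 1) \<or>
    (occupied a \<nu> p \<and> \<not> int (d + L) dvd p - (i + a - \<nu> i))"
  proof (cases "int d dvd m - i")
    case True
    then have "int (d + L) dvd (m - \<nu> m) - (i - \<nu> i)" using particle_cong_iff[OF assms] by blast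
    moreover have "p - (i + a - \<nu> i - 1) = (m - \<nu> m) - (i - \<nu> i)" using True by (simp add: m)
    ultimately show ?thesis by metis
  next
    case False
    then have "\<not> int (d + L) dvd (m - \<nu> m) - (i - \<nu> i)" using particle_cong_iff[OF assms] by blast
    moreover have "p - (i + a - \<nu> i) = (m - \<nu> m) - (i - \<nu> i)" using False by (simp add: m)
    moreover have "occupied a \<nu> p" using False by (auto simp: m occupied_def)
    ultimately show ?thesis by metis
  qed
next
  assume "int (d + L) dvd p - (i + a - \<nu> i - 1) \<or>
    (occupied a \<nu> p \<and> \<not> int (d + L) dvd p - (i + a - \<nu> i))"
  then show "occupied a (add_cell d i \<nu>) p"
  proof (elim disjE conjE)
    assume "int (d + L) dvd p - (i + a - \<nu> i - 1)"
    moreover have "p - (i + a - \<nu> i - 1) = (p + 1) - (i + a - \<nu> i)" by simp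
    ultimately have "int (d + L) dvd (p + 1) - (i + a - \<nu> i)" by simp
    then obtain j where "p + 1 = j + a - \<nu> j" "int d dvd j - i"
      using particle_lift[OF assms] by metis
    then show ?thesis by (auto simp: occupied_def add_cell_def intro!: exI[of _ j])
  next
    assume "occupied a \<nu> p" and not: "\<not> int (d + L) dvd p - (i + a - \<nu> i)"
    then obtain m where m: "p = m + a - \<nu> m" by (auto simp: occupied_def)
    then have "p - (i + a - \<nu> i) = (m - \<nu> m) - (i - \<nu> i)" by simp
    then have "\<not> int (d + L) dvd (m - \<nu> m) - (i - \<nu> i)" using not by metis
    then have "\<not> int d dvd m - i" using particle_cong_iff[OF assms] by blast
    then show ?thesis using m by (auto simp: occupied_def add_cell_def)
  qed
qed

lemma addable_iff_site_empty:
  assumes "\<nu> \<in> cylindric_shapes d L"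
  shows "\<nu> i < \<nu> (i - 1) \<longleftrightarrow> \<not> occupied a \<nu> (i + a - \<nu> i - 1)"
proof
  assume less: "\<nu> i < \<nu> (i - 1)"
  show "\<not> occupied a \<nu> (i + a - \<nu> i - 1)"
  proof
    assume "occupied a \<nu> (i + a - \<nu> i - 1)"
    then obtain j where "i + a - \<nu> i - 1 = j + a - \<nu> j" unfolding occupied_def by blast
    then have j: "j - \<nu> j = i - \<nu> i - 1" by simp
    then have "j < i" using particle_strict_mono[OF assms, of i j] by (cases i j rule: linorder_cases) auto
    then have "j - \<nu> j \<le> (i - 1) - \<nu> (i - 1)"
      using shape_antimono[OF assms, of j "i - 1"] by simp
    then show False using j less by simp
  qed
next
  assume empty: "\<not> occupied a \<nu> (i + a - \<nu> i - 1)"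
  have "\<nu> i \<noteq> \<nu> (i - 1)"
  proof
    assume "\<nu> i = \<nu> (i - 1)"
    then have "occupied a \<nu> (i + a - \<nu> i - 1)"
      unfolding occupied_def by (intro exI[of _ "i - 1"]) simp
    then show False using empty by contradiction
  qed
  then show "\<nu> i < \<nu> (i - 1)" using shape_antimono[OF assms, of "i - 1" i] by simp
qed

lemma site_eq_iff:
  assumes "t < N"
  shows "t = nat (p mod int N) \<longleftrightarrow> int N dvd int t - p"
proof -
  have "int N > 0" using assms by simp
  then have "t = nat (p mod int N) \<longleftrightarrow> int t mod int N = p mod int N" using assms by auto
  then show ?thesis by (simp add: mod_eq_dvd_iff)
qed

lemma Suc_site_mod:
  assumes "N > 0"
  shows "Suc (nat (p mod int N)) mod N = nat ((p + 1) mod int N)"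
proof -
  have "int (Suc (nat (p mod int N)) mod N) = (p mod int N + 1) mod int N"
    using assms by (simp add: zmod_int add.commute)
  then have "int (Suc (nat (p mod int N)) mod N) = (p + 1) mod int N" by (simp add: mod_add_left_eq)
  then show ?thesis by linarith
qed

text \<open>
  Particle \<open>i\<close> is at site \<open>i + a - \<nu>\<^sub>i\<close> and jumps to the site before it; as list positions
  count from zero, the target has list index \<open>i + a - \<nu>\<^sub>i - 2\<close> modulo \<open>d + L\<close>.
\<close>

lemma shape_state_hop_at:
  assumes "d \<ge> 1" "L \<ge> 1" and \<nu>: "\<nu> \<in> cylindric_shapes d L" and less: "\<nu> i < \<nu> (i - 1)"
  shows "hop_at (shape_state d L a \<nu>) (nat ((i + a - \<nu> i - 2) mod int (d + L)))
    (shape_state d L a (add_cell d i \<nu>))"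
proof -
  let ?N = "d + L"
  let ?p = "nat ((i + a - \<nu> i - 2) mod int ?N)"
  let ?q = "nat ((i + a - \<nu> i - 1) mod int ?N)"
  have N: "?N > 0" using assms by simp
  have lt: "?p < ?N" "?q < ?N"
    using N pos_mod_bound[of "int ?N"] by (simp_all add: nat_less_iff del: of_nat_add)
  have "i + a - \<nu> i - 2 + 1 = i + a - \<nu> i - 1" by simp
  then have q: "Suc ?p mod ?N = ?q" using Suc_site_mod[OF N, of "i + a - \<nu> i - 2"] by metis
  have p_iff: "t = ?p \<longleftrightarrow> int ?N dvd (int t + 1) - (i + a - \<nu> i - 1)" if "t < ?N" for t
    using site_eq_iff[OF that, of "i + a - \<nu> i - 2"] by (simp add: algebra_simps)
  have q_iff: "t = ?q \<longleftrightarrow> int ?N dvd (int t + 1) - (i + a - \<nu> i)" if "t < ?N" for t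
    using site_eq_iff[OF that, of "i + a - \<nu> i - 1"] by (simp add: algebra_simps)
  have "\<not> occupied a \<nu> (int ?p + 1)"
    using occupied_cong[OF \<nu>] p_iff[OF lt(1)] addable_iff_site_empty[OF \<nu>] less by blast
  moreover have "occupied a \<nu> (int ?q + 1)"
  proof -
    have "occupied a \<nu> (i + a - \<nu> i)" by (auto simp: occupied_def)
    then show ?thesis using occupied_cong[OF \<nu>] q_iff[OF lt(2)] by blast
  qed
  moreover have "shape_state d L a (add_cell d i \<nu>) ! t \<longleftrightarrow>
      t = ?p \<or> (shape_state d L a \<nu> ! t \<and> t \<noteq> ?q)" if "t < ?N" for t
    unfolding nth_shape_state[OF that] occupied_add_cell[OF \<nu>] p_iff[OF that] q_iff[OF that] ..
  ultimately show ?thesis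
    using lt unfolding hop_at_def length_shape_state q by (simp add: nth_shape_state)
qed

text \<open>
  Different shapes can have the same state, but among the shapes that arise from a given one
  by adding a cell, the state determines the particle that moved and hence the row.
\<close>

lemma shape_state_covering:
  assumes "d \<ge> 1" "L \<ge> 1"
  shows "covering (shape_graph d L) (state_graph d L) (shape_state d L a)
    (map_prod (shape_state d L a) (shape_state d L a))"
proof (rule coveringI_simple)
  let ?s = "shape_state d L a"
  fix \<nu> \<mu> assume "\<nu> \<in> verts (shape_graph d L)" and arc: "(\<nu>, \<mu>) \<in> arcs (shape_graph d L)"
  then have \<nu>: "\<nu> \<in> cylindric_shapes d L" and \<mu>: "\<mu> \<in> cylindric_shapes d L"
    by (auto simp: shape_graph_def)
  obtain i where i: "\<nu> i < \<nu> (i - 1)" "\<mu> = add_cell d i \<nu>"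
    using arc shape_graph_arc_iff[OF assms \<nu>] by blast
  have hop: "hop_at (?s \<nu>) (nat ((i + a - \<nu> i - 2) mod int (d + L))) (?s \<mu>)"
    using shape_state_hop_at[OF assms \<nu> i(1)] i(2) by simp
  then have "hop (?s \<nu>) (?s \<mu>)" using hop_iff_hop_at by blast
  then show "(?s \<nu>, ?s \<mu>) \<in> arcs (state_graph d L)"
    using shape_state_in_states[OF assms(1)] \<nu> \<mu> by (simp add: state_graph_def)
  fix \<mu>' assume arc': "(\<nu>, \<mu>') \<in> arcs (shape_graph d L)" and eq: "?s \<mu> = ?s \<mu>'"
  obtain j where j: "\<nu> j < \<nu> (j - 1)" "\<mu>' = add_cell d j \<nu>"
    using arc' shape_graph_arc_iff[OF assms \<nu>] by blast
  have "hop_at (?s \<nu>) (nat ((j + a - \<nu> j - 2) mod int (d + L))) (?s \<mu>)"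
    using shape_state_hop_at[OF assms \<nu> j(1)] j(2) eq by simp
  then have "nat ((i + a - \<nu> i - 2) mod int (d + L)) = nat ((j + a - \<nu> j - 2) mod int (d + L))"
    using hop by (metis hop_at_site_unique)
  moreover have "int (d + L) > 0" using assms by simp
  ultimately have "(i + a - \<nu> i - 2) mod int (d + L) = (j + a - \<nu> j - 2) mod int (d + L)"
    by (metis eq_nat_nat_iff pos_mod_sign)
  then have "int (d + L) dvd (i - \<nu> i) - (j - \<nu> j)" by (simp add: mod_eq_dvd_iff algebra_simps)
  then have "int d dvd i - j" using particle_cong_iff[OF \<nu>] by blast
  then show "\<mu> = \<mu>'" using add_cell_cong i(2) j(2) by metis
next
  let ?s = "shape_state d L a"
  fix \<nu> z assume "\<nu> \<in> verts (shape_graph d L)" and "(?s \<nu>, z) \<in> arcs (state_graph d L)"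
  then have \<nu>: "\<nu> \<in> cylindric_shapes d L" and "hop (?s \<nu>) z"
    by (auto simp: shape_graph_def state_graph_def)
  then obtain p where hop: "hop_at (?s \<nu>) p z" using hop_iff_hop_at by blast
  then have p: "p < d + L" by (simp add: hop_at_def)
  then have q: "Suc p mod (d + L) < d + L" by (intro mod_less_divisor) linarith
  have occ: "\<not> occupied a \<nu> (int p + 1)" "occupied a \<nu> (int (Suc p mod (d + L)) + 1)"
    using hop p by (simp_all add: hop_at_def nth_shape_state flip: nth_shape_state[OF q])
  have "int (d + L) dvd (int (Suc p mod (d + L)) + 1) - (int p + 2)"
    using mod_eq_dvd_iff[of "int (Suc p) mod int (d + L)" "int (d + L)" "int (Suc p)"]
    by (simp add: zmod_int algebra_simps)
  then have "occupied a \<nu> (int p + 2)" using occ(2) occupied_cong[OF \<nu>] by blast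
  then obtain i where i: "int p + 2 = i + a - \<nu> i" by (auto simp: occupied_def)
  then have "i + a - \<nu> i - 1 = int p + 1" by simp
  then have less: "\<nu> i < \<nu> (i - 1)" using occ(1) addable_iff_site_empty[OF \<nu>, of i a] by metis
  have "nat ((i + a - \<nu> i - 2) mod int (d + L)) = p" using p by (simp flip: i)
  then have "hop_at (?s \<nu>) p (?s (add_cell d i \<nu>))"
    using shape_state_hop_at[OF assms \<nu> less, of a] by simp
  then have "?s (add_cell d i \<nu>) = z" using hop hop_at_result_unique by blast
  then show "\<exists>\<mu>. (\<nu>, \<mu>) \<in> arcs (shape_graph d L) \<and> ?s \<mu> = z"
    using less shape_graph_arc_iff[OF assms \<nu>] by blast
qed (auto simp: shape_graph_def state_graph_def shape_state_in_states[OF assms(1)])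

text \<open>
  Relative to the origin \<open>\<alpha>\<^sub>0\<close>, particle \<open>0\<close> sits at site \<open>0\<close>, and \<open>x\<^sub>i\<close> empty sites
  separate the particles \<open>i - 1\<close> and \<open>i\<close>.
\<close>

lemma shape_state_eq_gap_string:
  assumes "\<alpha> \<in> cylindric_shapes d L"
  shows "shape_state d L (\<alpha> 0) \<alpha> = gap_string (gaps d \<alpha>)"
proof -
  have "gap_string (map (\<lambda>i. nat (\<alpha> (i - 1) - \<alpha> i)) [1..int m]) =
      map (occupied (\<alpha> 0) \<alpha>) [1..int m + \<alpha> 0 - \<alpha> (int m)]" for m
  proof (induction m)
    case 0
    then show ?case by (simp add: gap_string_def)
  next
    case (Suc m)
    let ?A = "int m + \<alpha> 0 - \<alpha> (int m)"
    let ?B = "int m + \<alpha> 0 - \<alpha> (int m + 1)"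
    have "\<alpha> (int m) \<le> \<alpha> 0" "\<alpha> (int m + 1) \<le> \<alpha> (int m)"
      using shape_antimono[OF assms] by simp_all
    then have A: "0 \<le> ?A" "?A \<le> ?B" by simp_all
    have "map (occupied (\<alpha> 0) \<alpha>) [?A + 1..?B] = replicate (nat (\<alpha> (int m) - \<alpha> (int m + 1))) False"
    proof (rule replicate_eqI)
      fix b assume "b \<in> set (map (occupied (\<alpha> 0) \<alpha>) [?A + 1..?B])"
      then obtain p where p: "b = occupied (\<alpha> 0) \<alpha> p" "?A < p" "p \<le> ?B" by auto
      have False if p_eq: "p = i + \<alpha> 0 - \<alpha> i" for i
      proof (cases "i \<le> int m")
        case True
        then show False using p p_eq shape_antimono[OF assms, of i "int m"] by simp
      next
        case False
        then show False using p p_eq shape_antimono[OF assms, of "int m + 1" i] by simp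
      qed
      then show "b = False" unfolding p(1) occupied_def by blast
    qed simp
    moreover have "int (Suc m) + \<alpha> 0 - \<alpha> (int (Suc m)) = ?B + 1" by (simp add: add.commute)
    moreover have "occupied (\<alpha> 0) \<alpha> (?B + 1)"
      unfolding occupied_def by (intro exI[of _ "int m + 1"]) simp
    moreover have "[1..?B + 1] = [1..?A] @ [?A + 1..?B] @ [?B + 1]"
    proof -
      have "[1..?B + 1] = [1..?B] @ [?B + 1]" using A upto_rec2[of 1 "?B + 1"] by simp
      also have "[1..?B] = [1..?A] @ [?A + 1..?B]"
      proof (cases "?A = ?B")
        case False
        then show ?thesis using A upto_split1[of 1 "?A + 1" "?B"] by simp
      qed simp
      finally show ?thesis by simp
    qed
    moreover have "[1..int (Suc m)] = [1..int m] @ [int m + 1]"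
      using upto_rec2[of 1 "int m + 1"] by (simp add: add.commute)
    moreover have "map (\<lambda>i. nat (\<alpha> (i - 1) - \<alpha> i)) [int m + 1] = [nat (\<alpha> (int m) - \<alpha> (int m + 1))]"
      by simp
    moreover have "gap_string (xs @ [x]) = gap_string xs @ replicate x False @ [True]" for xs x
      by (simp add: gap_string_def)
    ultimately show ?case using Suc.IH by (simp only: map_append) simp
  qed
  from this[of d] have "gap_string (gaps d \<alpha>) = map (occupied (\<alpha> 0) \<alpha>) [1..int d + \<alpha> 0 - \<alpha> (int d)]"
    by (simp add: gaps_def)
  also have "int d + \<alpha> 0 - \<alpha> (int d) = int (d + L)"
    using shape_shift[OF assms, of "int d" 1] by simp
  finally show ?thesis by (simp add: shape_state_def occupied_def)
qed


section \<open>Reversal and complement\<close>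

lemma length_rev_compl [simp]: "length (rev_compl u) = length u"
  by (simp add: rev_compl_def)

lemma nth_rev_compl: "t < length u \<Longrightarrow> rev_compl u ! t \<longleftrightarrow> \<not> u ! (length u - 1 - t)"
  by (simp add: rev_compl_def rev_nth)

lemma rev_compl_rev_compl [simp]: "rev_compl (rev_compl u) = u"
  by (simp add: rev_compl_def rev_map comp_def)

lemma rev_compl_in_states:
  assumes "u \<in> states d L"
  shows "rev_compl u \<in> states L d"
proof -
  have "count_list (rev_compl u) True = length (filter Not u)"
    by (simp add: rev_compl_def count_list_eq_length_filter rev_filter[symmetric] filter_map comp_def)
  moreover have "length (filter Not u) + count_list u True = length u"
    by (induction u) auto
  ultimately show ?thesis using assms by (simp add: states_def)
qed

text \<open>
  When a particle jumps to the left, an empty site moves to the right. Reversal makes the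
  empty site move to the left, and complementing turns it into a particle.
\<close>

lemma hop_rev_compl:
  assumes "hop u v"
  shows "hop (rev_compl u) (rev_compl v)"
proof -
  obtain p where p: "hop_at u p v" using assms hop_iff_hop_at by blast
  let ?N = "length u"
  let ?q = "Suc p mod ?N"
  let ?p' = "?N - 1 - ?q"
  have lt: "p < ?N" using p by (simp add: hop_at_def)
  then have q: "?q < ?N" by (intro mod_less_divisor) linarith
  have q': "Suc ?p' mod ?N = ?N - 1 - p"
  proof (cases "Suc p = ?N")
    case True
    then have "Suc ?p' = ?N" by simp
    then show ?thesis using True by simp
  next
    case False
    then show ?thesis using lt by (simp add: Suc_diff_Suc)
  qed
  have ne: "?q \<noteq> p" using p by (auto simp: hop_at_def)
  have v: "v ! t \<longleftrightarrow> t = p \<or> (u ! t \<and> t \<noteq> ?q)" if "t < ?N" for t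
    using p that by (simp add: hop_at_def)
  have len: "length v = ?N" using p by (simp add: hop_at_def)
  have "rev_compl v ! t \<longleftrightarrow> t = ?p' \<or> (rev_compl u ! t \<and> t \<noteq> ?N - 1 - p)" if "t < ?N" for t
  proof -
    have "?N - 1 - t < ?N" "?N - 1 - t = p \<longleftrightarrow> t = ?N - 1 - p" "?N - 1 - t = ?q \<longleftrightarrow> t = ?p'"
      using that lt q by auto
    then show ?thesis
      using that v[of "?N - 1 - t"] ne lt q by (auto simp: nth_rev_compl len)
  qed
  moreover have "\<not> rev_compl u ! ?p'" "rev_compl u ! (?N - 1 - p)"
    using p lt q by (simp_all add: nth_rev_compl hop_at_def)
  ultimately have "hop_at (rev_compl u) ?p' (rev_compl v)"
    using q lt unfolding hop_at_def length_rev_compl q' len by simp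
  then show ?thesis using hop_iff_hop_at by blast
qed

lemma rev_compl_covering:
  "covering (state_graph d L) (state_graph L d) rev_compl (map_prod rev_compl rev_compl)"
proof (rule coveringI_simple)
  fix u v assume "(u, v) \<in> arcs (state_graph d L)"
  then show "(rev_compl u, rev_compl v) \<in> arcs (state_graph L d)"
    by (simp add: state_graph_def rev_compl_in_states hop_rev_compl)
next
  fix u v v' assume "rev_compl v = rev_compl v'"
  then show "v = v'" by (metis rev_compl_rev_compl)
next
  fix u z assume "u \<in> verts (state_graph d L)" "(rev_compl u, z) \<in> arcs (state_graph L d)"
  then have "(u, rev_compl z) \<in> arcs (state_graph d L)"
    using hop_rev_compl[of "rev_compl u" z] by (simp add: state_graph_def rev_compl_in_states)
  then show "\<exists>v. (u, v) \<in> arcs (state_graph d L) \<and> rev_compl v = z"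
    by (intro exI[of _ "rev_compl z"]) simp
qed (auto simp: state_graph_def rev_compl_in_states)


section \<open>Projection to necklaces\<close>

lemma Suc_mod_inj:
  assumes "s < N" "t < N"
  shows "Suc s mod N = Suc t mod N \<longleftrightarrow> s = t"
  using assms by (auto simp: mod_Suc split: if_splits)

lemma hop_rotate1D:
  assumes len: "length v = length u" and hop: "hop (rotate1 u) (rotate1 v)"
  shows "hop u v"
proof -
  let ?N = "length u"
  obtain p where p: "hop_at (rotate1 u) p (rotate1 v)" using hop hop_iff_hop_at by blast
  then have lt: "p < ?N" by (simp add: hop_at_def)
  then have N: "?N > 0" by linarith
  let ?p = "Suc p mod ?N"
  have q: "?p < ?N" using N by (rule mod_less_divisor)
  have u: "\<not> u ! ?p" "u ! (Suc ?p mod ?N)"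
    using p lt q by (simp_all add: hop_at_def nth_rotate1)
  have "v ! t \<longleftrightarrow> t = ?p \<or> (u ! t \<and> t \<noteq> Suc ?p mod ?N)" if "t < ?N" for t
  proof -
    define s where "s = (if t = 0 then ?N - 1 else t - 1)"
    have s: "s < ?N" "Suc s mod ?N = t" using that by (auto simp: s_def)
    have "rotate1 v ! s \<longleftrightarrow> s = p \<or> (rotate1 u ! s \<and> s \<noteq> ?p)"
      using p s(1) by (simp add: hop_at_def)
    then show ?thesis
      using Suc_mod_inj[OF s(1) lt] Suc_mod_inj[OF s(1) q] s len by (simp add: nth_rotate1)
  qed
  then have "hop_at u ?p v" using u q len unfolding hop_at_def by blast
  then show ?thesis using hop_iff_hop_at by blast
qed

text \<open>Rotation by \<open>k\<close> is undone by rotation by \<open>k (N - 1)\<close>, since \<open>k + k (N - 1)\<close> is a multiple of \<open>N\<close>.\<close>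

lemma rotate_back:
  "rotate k (rotate (k * (length u - 1)) u) = u" "rotate (k * (length u - 1)) (rotate k u) = u"
proof -
  have "(k + k * (length u - 1)) mod length u = 0" if "length u > 0"
  proof -
    have "k + k * (length u - 1) = k * length u" using that by (cases "length u") auto
    then show ?thesis by simp
  qed
  then have "rotate (k + k * (length u - 1)) u = u"
    by (cases "u = []") (auto intro: rotate_id)
  then show "rotate k (rotate (k * (length u - 1)) u) = u" "rotate (k * (length u - 1)) (rotate k u) = u"
    by (simp_all add: rotate_rotate add.commute)
qed

lemma hop_rotate_iff:
  assumes len: "length v = length u"
  shows "hop (rotate k u) (rotate k v) \<longleftrightarrow> hop u v"
proof -
  have D: "hop u v" if "length v = length u" "hop (rotate k u) (rotate k v)" for k u v
    using that(2)
  proof (induction k)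
    case (Suc k)
    then show ?case using hop_rotate1D[of "rotate k v" "rotate k u"] that(1) by simp
  qed simp
  show ?thesis
    using D[OF len, of k] D[of "rotate k v" "rotate k u" "k * (length u - 1)"]
      rotate_back(2)[of k u] rotate_back(2)[of k v] len by auto
qed

lemma rotate_in_necklace_iff: "rotate k u \<in> necklace w \<longleftrightarrow> u \<in> necklace w"
proof
  assume "rotate k u \<in> necklace w"
  then obtain j where "rotate k u = rotate j w" by (auto simp: necklace_def)
  then have "u = rotate (k * (length u - 1)) (rotate j w)" using rotate_back(2)[of k u] by simp
  then show "u \<in> necklace w" by (auto simp: necklace_def rotate_rotate)
qed (auto simp: necklace_def rotate_rotate)

lemma self_in_necklace: "u \<in> necklace u"
  unfolding necklace_def by (auto intro: exI[of _ 0])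

lemma necklace_eq:
  assumes "u \<in> necklace w"
  shows "necklace u = necklace w"
proof -
  obtain k where k: "u = rotate k w" using assms by (auto simp: necklace_def)
  have "w \<in> necklace u" using self_in_necklace[of u] rotate_in_necklace_iff[of k w u] k by simp
  then obtain j where j: "w = rotate j u" by (auto simp: necklace_def)
  have "v \<in> necklace u \<longleftrightarrow> v \<in> necklace w" for v
  proof
    assume "v \<in> necklace u"
    then obtain m where "v = rotate m (rotate k w)" using k by (auto simp: necklace_def)
    then show "v \<in> necklace w" by (auto simp: necklace_def rotate_rotate)
  next
    assume "v \<in> necklace w"
    then obtain m where "v = rotate m (rotate j u)" using j by (auto simp: necklace_def)
    then show "v \<in> necklace u" by (auto simp: necklace_def rotate_rotate)
  qed
  then show ?thesis by blast
qed

lemma finite_necklace: "finite (necklace u)"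
  by (rule finite_subset[OF _ finite_lists_length_eq[of UNIV "length u"]]) (auto simp: necklace_def)

lemma hop_in_states:
  assumes "u \<in> states d L" "hop u v"
  shows "v \<in> states d L"
proof -
  obtain p where p: "hop_at u p v" using assms hop_iff_hop_at by blast
  let ?q = "Suc p mod length u"
  have lt: "p < length u" using p by (simp add: hop_at_def)
  then have q: "?q < length u" by (intro mod_less_divisor) linarith
  let ?U = "{t. t < length u \<and> u ! t}"
  have "{t. t < length v \<and> v ! t} = insert p (?U - {?q})"
    using p lt by (auto simp: hop_at_def)
  moreover have "p \<notin> ?U" "?q \<in> ?U" using p q by (auto simp: hop_at_def)
  moreover from this have "card ?U > 0" by (auto simp: card_gt_0_iff)
  ultimately have "card {t. t < length v \<and> v ! t} = card ?U"
    by (metis (no_types, lifting) Suc_pred' card_Diff_singleton card_gt_0_iff card_insert_disjoint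
        Diff_iff finite_Diff)
  then have "count_list v True = count_list u True" by (simp only: count_list_True)
  moreover have "length v = length u" using p by (simp add: hop_at_def)
  ultimately show ?thesis using assms(1) by (simp add: states_def)
qed

text \<open>
  The definition counts the hops from an arbitrary representative; rotating source and
  target together shows that every representative gives the same number.
\<close>

lemma edge_mult_necklace:
  "edge_mult (necklace u) (necklace w) = card {v \<in> necklace w. hop u v}"
proof -
  obtain k where k: "(SOME u'. u' \<in> necklace u) = rotate k u"
    using someI[of "\<lambda>u'. u' \<in> necklace u", OF self_in_necklace] by (auto simp: necklace_def)
  have len: "length v = length u" if "hop u v" for u v using that by (simp add: hop_def)
  have "bij_betw (rotate k) {v \<in> necklace w. hop u v} {v \<in> necklace w. hop (rotate k u) v}"
  proof (rule bij_betw_byWitness[where f' = "rotate (k * (length u - 1))"])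
    show "\<forall>v\<in>{v \<in> necklace w. hop u v}. rotate (k * (length u - 1)) (rotate k v) = v"
      using rotate_back(2) len by (metis (no_types, lifting) mem_Collect_eq)
    show "\<forall>v\<in>{v \<in> necklace w. hop (rotate k u) v}. rotate k (rotate (k * (length u - 1)) v) = v"
      using rotate_back(1) len length_rotate by (metis (no_types, lifting) mem_Collect_eq)
    show "rotate k ` {v \<in> necklace w. hop u v} \<subseteq> {v \<in> necklace w. hop (rotate k u) v}"
      using len by (auto simp: rotate_in_necklace_iff hop_rotate_iff)
    show "rotate (k * (length u - 1)) ` {v \<in> necklace w. hop (rotate k u) v} \<subseteq>
        {v \<in> necklace w. hop u v}"
    proof clarify
      fix v assume v: "v \<in> necklace w" "hop (rotate k u) v"
      let ?v = "rotate (k * (length u - 1)) v"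
      have "length v = length u" using len[OF v(2)] by simp
      then have "rotate k ?v = v" "length ?v = length u" using rotate_back(1)[of k v] by simp_all
      then have "hop u ?v" using v(2) hop_rotate_iff[of ?v u k] by simp
      then show "?v \<in> necklace w \<and> hop u ?v" using v(1) by (simp add: rotate_in_necklace_iff)
    qed
  qed
  then show ?thesis by (simp add: edge_mult_def k bij_betw_same_card)
qed

text \<open>
  Ranks strictly increase along \<open>r\<close>, so they are distinct; being less than \<open>card S\<close>,
  they exhaust the initial segment.
\<close>

lemma rank_bij_betw:
  assumes "finite S" "irrefl r" "trans r" "total_on S r"
  shows "bij_betw (\<lambda>v. card {w \<in> S. (w, v) \<in> r}) S {..<card S}"
proof -
  let ?rank = "\<lambda>v. card {w \<in> S. (w, v) \<in> r}"
  have mono: "?rank v < ?rank v'" if "v \<in> S" "(v, v') \<in> r" for v v'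
  proof (rule psubset_card_mono)
    have "v \<notin> {w \<in> S. (w, v) \<in> r}" using assms(2) by (auto simp: irrefl_def)
    then show "{w \<in> S. (w, v) \<in> r} \<subset> {w \<in> S. (w, v') \<in> r}"
      using that assms(3) by (auto dest: transD)
  qed (use assms(1) in simp)
  have inj: "inj_on ?rank S"
  proof (rule inj_onI)
    fix v v' assume "v \<in> S" "v' \<in> S" "?rank v = ?rank v'"
    then show "v = v'" using mono[of v v'] mono[of v' v] assms(4) by (auto simp: total_on_def)
  qed
  moreover have "?rank ` S \<subseteq> {..<card S}"
  proof
    fix m assume "m \<in> ?rank ` S"
    then obtain v where v: "v \<in> S" "m = ?rank v" by blast
    then have "{w \<in> S. (w, v) \<in> r} \<subset> S" using assms(2) by (auto simp: irrefl_def)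
    then show "m \<in> {..<card S}" using v psubset_card_mono[OF assms(1)] by simp
  qed
  then have "?rank ` S = {..<card S}"
    by (intro card_subset_eq) (simp_all add: card_image[OF inj])
  ultimately show ?thesis by (simp add: bij_betw_def)
qed

lemma lexord_bool_strict_linear:
  "irrefl (lexord {(False, True)})" "trans (lexord {(False, True)})"
  "total_on S (lexord {(False, True)})"
proof -
  show "irrefl (lexord {(False, True)})"
    by (rule lexord_irrefl) (simp add: irrefl_def)
  show "trans (lexord {(False, True)})"
    by (rule lexord_transI) (simp add: trans_def)
  have "(a, b) \<in> {(False, True)} \<or> a = b \<or> (b, a) \<in> {(False, True)}" for a b by auto
  then show "total_on S (lexord {(False, True)})"
    unfolding total_on_def using lexord_linear by blast
qed

text \<open>
  The arcs from the necklace of \<open>u\<close> to a necklace \<open>Q\<close> are as many as the hops from \<open>u\<close>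
  into \<open>Q\<close>, whichever representative is used to count them; ranking those hops
  therefore uses each arc once.
\<close>

lemma necklace_covering: "covering (state_graph d L) (necklace_graph d L) necklace project_arc"
proof -
  have "bij_betw project_arc (out_arcs (state_graph d L) u) (out_arcs (necklace_graph d L) (necklace u))"
    if u: "u \<in> states d L" for u
  proof -
    let ?S = "\<lambda>Q. {v \<in> Q. hop u v}"
    let ?rank = "\<lambda>Q v. card {w \<in> ?S Q. (w, v) \<in> lexord {(False, True)}}"
    have rank: "bij_betw (?rank (necklace w)) (?S (necklace w)) {..<card (?S (necklace w))}" for w
      using finite_necklace[of w] lexord_bool_strict_linear by (intro rank_bij_betw) auto
    have out: "out_arcs (state_graph d L) u = {(u, v) | v. hop u v}"
      using u hop_in_states by (auto simp: state_graph_def)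
    have out': "out_arcs (necklace_graph d L) (necklace u) =
        {(necklace u, k, Q) | k Q. Q \<in> necklace ` states d L \<and> k < card (?S Q)}"
      using u by (auto simp: necklace_graph_def edge_mult_necklace)
    have proj: "project_arc (u, v) = (necklace u, ?rank (necklace v) v, necklace v)" for v
      by (simp add: project_arc_def)
    have "inj_on project_arc {(u, v) | v. hop u v}"
    proof (rule inj_onI)
      fix e e' assume "e \<in> {(u, v) | v. hop u v}" "e' \<in> {(u, v) | v. hop u v}"
        and eq: "project_arc e = project_arc e'"
      then obtain v v' where e: "e = (u, v)" "e' = (u, v')" and hop: "hop u v" "hop u v'" by blast
      have Q: "necklace v = necklace v'" and "?rank (necklace v) v = ?rank (necklace v) v'"
        using eq unfolding e proj by auto
      moreover have "v \<in> ?S (necklace v)" "v' \<in> ?S (necklace v)"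
        using hop Q self_in_necklace by auto
      ultimately show "e = e'" unfolding e using inj_onD[OF bij_betw_imp_inj_on[OF rank]] by blast
    qed
    moreover have "project_arc ` {(u, v) | v. hop u v} =
        {(necklace u, k, Q) | k Q. Q \<in> necklace ` states d L \<and> k < card (?S Q)}"
    proof (intro equalityI subsetI)
      fix e assume "e \<in> project_arc ` {(u, v) | v. hop u v}"
      then obtain v where v: "hop u v" "e = project_arc (u, v)" by blast
      then have "v \<in> ?S (necklace v)" using self_in_necklace by simp
      then have "?rank (necklace v) v < card (?S (necklace v))"
        using bij_betwE[OF rank] by blast
      then show "e \<in> {(necklace u, k, Q) | k Q. Q \<in> necklace ` states d L \<and> k < card (?S Q)}"
        using v hop_in_states[OF u] by (auto simp: proj)
    next
      fix e assume "e \<in> {(necklace u, k, Q) | k Q. Q \<in> necklace ` states d L \<and> k < card (?S Q)}"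
      then obtain k w where e: "e = (necklace u, k, necklace w)" "k < card (?S (necklace w))" by auto
      then have "k \<in> ?rank (necklace w) ` ?S (necklace w)"
        using bij_betw_imp_surj_on[OF rank] by blast
      then obtain v where v: "k = ?rank (necklace w) v" "v \<in> necklace w" "hop u v" by blast
      then have "e = project_arc (u, v)" using e(1) necklace_eq[OF v(2)] by (simp add: proj)
      then show "e \<in> project_arc ` {(u, v) | v. hop u v}" using v(3) by blast
    qed
    ultimately show ?thesis unfolding out out' by (simp add: bij_betw_def)
  qed
  then show ?thesis
    unfolding covering_def
    by (auto simp: state_graph_def necklace_graph_def project_arc_def)
qed


section \<open>Conjugation\<close>

text \<open>
  The maximum in the definition of the conjugate exists because a shape is unbounded in both
  directions: by periodicity, row \<open>- m d\<close> has length \<open>\<nu>\<^sub>0 + m L\<close>.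
\<close>

lemma le_conjugate_iff:
  assumes "d \<ge> 1" "L \<ge> 1" and \<nu>: "\<nu> \<in> cylindric_shapes d L"
  shows "i \<le> conjugate \<nu> j \<longleftrightarrow> j \<le> \<nu> i"
proof -
  \<comment> \<open>Rows \<open>a\<close> and \<open>b\<close> enclose the maximum; they are multiples of \<open>d\<close>, where periodicity
    gives the lengths.\<close>
  define a where "a = 0 - (\<bar>\<nu> 0\<bar> + \<bar>j\<bar>) * int d"
  define b where "b = 0 - (- (\<bar>\<nu> 0\<bar> + \<bar>j\<bar> + 1)) * int d"
  have L: "m \<le> m * int L" if "m \<ge> 0" for m using that assms(2) by (simp add: mult_le_cancel_left1)
  have a: "j \<le> \<nu> a"
    unfolding a_def shape_shift[OF \<nu>] using L[of "\<bar>\<nu> 0\<bar> + \<bar>j\<bar>"] by linarith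
  have b: "\<nu> b < j"
    unfolding b_def shape_shift[OF \<nu>] using L[of "\<bar>\<nu> 0\<bar> + \<bar>j\<bar> + 1"]
    unfolding mult_minus_left by linarith
  have less_b: "i < b" if "j \<le> \<nu> i" for i
    using that b shape_antimono[OF \<nu>, of b i] by linarith
  let ?S = "{i \<in> {a..b}. j \<le> \<nu> i}"
  have "finite ?S" by (rule finite_subset[of _ "{a..b}"]) auto
  moreover have "a \<in> ?S" using a less_b[OF a] by simp
  ultimately have S: "finite ?S" "a \<in> ?S" .
  define M where "M = Max ?S"
  have M: "j \<le> \<nu> M" "a \<le> M" using Max_in[of ?S] S unfolding M_def by auto
  have max: "i \<le> M" if "j \<le> \<nu> i" for i
  proof (cases "a \<le> i")
    case True
    then show ?thesis using less_b[OF that] that S unfolding M_def by (intro Max_ge) auto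
  qed (use M in simp)
  have "conjugate \<nu> j = M"
    unfolding conjugate_def using M(1) max by (intro Greatest_equality) auto
  then show ?thesis using max M(1) shape_antimono[OF \<nu>, of i M] by fastforce
qed

lemma conjugate_in_shapes:
  assumes "d \<ge> 1" "L \<ge> 1" and \<nu>: "\<nu> \<in> cylindric_shapes d L"
  shows "conjugate \<nu> \<in> cylindric_shapes L d"
proof -
  note le = le_conjugate_iff[OF assms]
  have "antimono (conjugate \<nu>)"
    using le by (intro antimonoI) (meson order.trans order_refl)
  moreover have "conjugate \<nu> j = conjugate \<nu> (j + int L) + int d" for j
  proof -
    have "i \<le> conjugate \<nu> j \<longleftrightarrow> i \<le> conjugate \<nu> (j + int L) + int d" for i
      using le[of i j] le[of "i - int d" "j + int L"] shape_shift[OF \<nu>, of i 1] by auto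
    then show ?thesis by (metis order_refl order_antisym)
  qed
  ultimately show ?thesis unfolding cylindric_shapes_def by blast
qed

lemma conjugate_conjugate:
  assumes "d \<ge> 1" "L \<ge> 1" and \<nu>: "\<nu> \<in> cylindric_shapes d L"
  shows "conjugate (conjugate \<nu>) = \<nu>"
proof
  fix i
  have "j \<le> conjugate (conjugate \<nu>) i \<longleftrightarrow> j \<le> \<nu> i" for j
    using le_conjugate_iff[OF assms] le_conjugate_iff[OF assms(2,1) conjugate_in_shapes[OF assms]]
    by blast
  then show "conjugate (conjugate \<nu>) i = \<nu> i" by (metis order_refl order_antisym)
qed

lemma swap_cell: "prod.swap ` cell d L i j = cell L d j i"
proof -
  have "\<exists>k'. (j + k * int L, i - k * int d) = (j - k' * int L, i + k' * int d)" for k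
    by (rule exI[of _ "- k"]) simp
  moreover have "\<exists>k'. (j - k * int L, i + k * int d) = (j + k' * int L, i - k' * int d)" for k
    by (rule exI[of _ "- k"]) simp
  ultimately show ?thesis unfolding cell_def by (fastforce simp: image_iff)
qed

lemma skew_young_conjugate:
  assumes "d \<ge> 1" "L \<ge> 1" "\<nu> \<in> cylindric_shapes d L" "\<alpha> \<in> cylindric_shapes d L"
  shows "c \<in> skew_young L d (conjugate \<nu>) (conjugate \<alpha>) \<longleftrightarrow> prod.swap ` c \<in> skew_young d L \<nu> \<alpha>"
proof -
  have mem: "cell L d j i \<in> skew_young L d (conjugate \<nu>) (conjugate \<alpha>) \<longleftrightarrow>
      cell d L i j \<in> skew_young d L \<nu> \<alpha>" for i j
    using assms by (auto simp: cell_in_skew_iff conjugate_in_shapes le_conjugate_iff not_le[symmetric])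
  have swap: "prod.swap ` prod.swap ` c = c" for c :: cell by (simp add: image_image)
  show ?thesis
  proof
    assume c: "c \<in> skew_young L d (conjugate \<nu>) (conjugate \<alpha>)"
    then obtain i j where "c = cell L d j i" by (rule skew_young_cases)
    then show "prod.swap ` c \<in> skew_young d L \<nu> \<alpha>" using c mem by (simp add: swap_cell)
  next
    assume c: "prod.swap ` c \<in> skew_young d L \<nu> \<alpha>"
    then obtain i j where ij: "prod.swap ` c = cell d L i j" by (rule skew_young_cases)
    then have "c = cell L d j i" using swap[of c] by (simp add: swap_cell)
    then show "c \<in> skew_young L d (conjugate \<nu>) (conjugate \<alpha>)" using c ij mem by simp
  qed
qed

lemma conjugate_tableau_in_SCT:
  assumes pos: "d \<ge> 1" "L \<ge> 1" and inner: "\<alpha> \<in> cylindric_shapes d L" and T: "T \<in> SCT d L n \<alpha>"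
  shows "conjugate_tableau d L \<alpha> T \<in> SCT L d n (conjugate \<alpha>)"
proof -
  obtain \<nu> F where T_eq: "T = (\<nu>, F)" by (cases T)
  have outer: "\<nu> \<in> cylindric_shapes d L" and ge: "\<alpha> \<le> \<nu>"
    and bij: "bij_betw F (skew_young d L \<nu> \<alpha>) {1..n}"
    using T by (auto simp: T_eq SCT_def)
  let ?Y = "skew_young L d (conjugate \<nu>) (conjugate \<alpha>)"
  let ?F = "restrict (\<lambda>c. F (prod.swap ` c)) ?Y"
  note conj_shapes = conjugate_in_shapes[OF pos outer] conjugate_in_shapes[OF pos inner]
  have mem: "c \<in> ?Y \<longleftrightarrow> prod.swap ` c \<in> skew_young d L \<nu> \<alpha>" for c
    by (rule skew_young_conjugate[OF pos outer inner])
  have swap: "prod.swap ` prod.swap ` c = c" for c :: cell by (simp add: image_image)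
  have "bij_betw (\<lambda>c. prod.swap ` c) ?Y (skew_young d L \<nu> \<alpha>)"
    by (rule bij_betw_byWitness[where f' = "\<lambda>c. prod.swap ` c"]) (auto simp: mem swap)
  then have "bij_betw (F \<circ> (\<lambda>c. prod.swap ` c)) ?Y {1..n}" using bij by (rule bij_betw_trans)
  then have bij': "bij_betw ?F ?Y {1..n}"
    by (rule iffD1[OF bij_betw_cong, rotated]) simp
  have ge': "conjugate \<alpha> \<le> conjugate \<nu>"
  proof (rule le_funI)
    fix j
    have "j \<le> \<alpha> (conjugate \<alpha> j)" using le_conjugate_iff[OF pos inner] by blast
    then have "j \<le> \<nu> (conjugate \<alpha> j)" using ge by (auto simp: le_fun_def intro: order.trans)
    then show "conjugate \<alpha> j \<le> conjugate \<nu> j" using le_conjugate_iff[OF pos outer] by blast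
  qed
  have "skew_size L (conjugate \<nu>) (conjugate \<alpha>) = int n"
    using card_skew_young[OF pos(2) conj_shapes ge'] bij_betw_same_card[OF bij'] by simp
  moreover have "?F (cell L d j i) < ?F (cell L d j (i + 1))"
    if "cell L d j i \<in> ?Y" "cell L d j (i + 1) \<in> ?Y" for i j
    using that T by (auto simp: mem swap_cell T_eq SCT_def)
  moreover have "?F (cell L d j i) < ?F (cell L d (j + 1) i)"
    if "cell L d j i \<in> ?Y" "cell L d (j + 1) i \<in> ?Y" for i j
    using that T by (auto simp: mem swap_cell T_eq SCT_def)
  ultimately show ?thesis
    using conj_shapes ge' bij' by (auto simp: T_eq conjugate_tableau_def SCT_def)
qed

lemma conjugate_tableau_conjugate_tableau:
  assumes pos: "d \<ge> 1" "L \<ge> 1" and inner: "\<alpha> \<in> cylindric_shapes d L" and T: "T \<in> SCT d L n \<alpha>"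
  shows "conjugate_tableau L d (conjugate \<alpha>) (conjugate_tableau d L \<alpha> T) = T"
proof -
  obtain \<nu> F where T_eq: "T = (\<nu>, F)" by (cases T)
  have outer: "\<nu> \<in> cylindric_shapes d L" and ext: "F \<in> extensional (skew_young d L \<nu> \<alpha>)"
    using T by (auto simp: T_eq SCT_def)
  note conj = conjugate_conjugate[OF pos outer] conjugate_conjugate[OF pos inner]
  let ?F = "restrict (\<lambda>c. F (prod.swap ` c)) (skew_young L d (conjugate \<nu>) (conjugate \<alpha>))"
  have "restrict (\<lambda>c. ?F (prod.swap ` c)) (skew_young d L \<nu> \<alpha>) = F"
    using ext skew_young_conjugate[OF pos outer inner]
    by (intro extensionalityI[OF restrict_extensional]) (auto simp: image_image)
  then show ?thesis by (simp add: T_eq conjugate_tableau_def conj)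
qed

lemma conjugate_tableau_bij_betw:
  assumes pos: "d \<ge> 1" "L \<ge> 1" and inner: "\<alpha> \<in> cylindric_shapes d L"
  shows "bij_betw (conjugate_tableau d L \<alpha>) (SCT d L n \<alpha>) (SCT L d n (conjugate \<alpha>))"
proof (rule bij_betw_byWitness[where f' = "conjugate_tableau L d (conjugate \<alpha>)"])
  note inner' = conjugate_in_shapes[OF pos inner]
  note conj = conjugate_conjugate[OF pos inner]
  show "\<forall>T\<in>SCT d L n \<alpha>. conjugate_tableau L d (conjugate \<alpha>) (conjugate_tableau d L \<alpha> T) = T"
    using conjugate_tableau_conjugate_tableau[OF assms] by blast
  show "\<forall>T\<in>SCT L d n (conjugate \<alpha>).
      conjugate_tableau d L \<alpha> (conjugate_tableau L d (conjugate \<alpha>) T) = T"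
    using conjugate_tableau_conjugate_tableau[OF pos(2,1) inner'] conj by simp
  show "conjugate_tableau d L \<alpha> ` SCT d L n \<alpha> \<subseteq> SCT L d n (conjugate \<alpha>)"
    using conjugate_tableau_in_SCT[OF assms] by blast
  show "conjugate_tableau L d (conjugate \<alpha>) ` SCT L d n (conjugate \<alpha>) \<subseteq> SCT d L n \<alpha>"
    using conjugate_tableau_in_SCT[OF pos(2,1) inner'] conj by auto
qed


section \<open>The bijections\<close>

lemma tableau_to_simplex_walk_bij_betw:
  assumes "d \<ge> 1" "L \<ge> 1" "\<alpha> \<in> cylindric_shapes d L"
  shows "bij_betw (tableau_to_simplex_walk d L n \<alpha>) (SCT d L n \<alpha>)
    (walks_from (simplex_graph d L) n (gaps d \<alpha>))"
proof -
  have "bij_betw (map (map_prod (gaps d) (gaps d))) (walks_from (shape_graph d L) n \<alpha>)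
      (walks_from (simplex_graph d L) n (gaps d \<alpha>))"
    using covering_bij_betw_walks[OF gaps_covering[OF assms(1,2)]] assms(3)
    by (simp add: shape_graph_def)
  from bij_betw_trans[OF tableaux_bij_betw_shape_walks[OF assms] this]
  show ?thesis by (simp add: comp_def map_path_through tableau_to_simplex_walk_def[abs_def])
qed

lemma tableau_to_state_walk_bij_betw:
  assumes "d \<ge> 1" "L \<ge> 1" "\<alpha> \<in> cylindric_shapes d L"
  shows "bij_betw (tableau_to_state_walk d L n \<alpha>) (SCT d L n \<alpha>)
    (walks_from (state_graph d L) n (gap_string (gaps d \<alpha>)))"
proof -
  let ?s = "shape_state d L (\<alpha> 0)"
  have "bij_betw (map (map_prod ?s ?s)) (walks_from (shape_graph d L) n \<alpha>)
      (walks_from (state_graph d L) n (?s \<alpha>))"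
    using covering_bij_betw_walks[OF shape_state_covering[OF assms(1,2)]] assms(3)
    by (simp add: shape_graph_def)
  from bij_betw_trans[OF tableaux_bij_betw_shape_walks[OF assms] this]
  show ?thesis
    by (simp add: comp_def map_path_through tableau_to_state_walk_def[abs_def]
        shape_state_eq_gap_string[OF assms(3)])
qed

lemma state_walk_to_necklace_walk_bij_betw:
  assumes "u \<in> states d L"
  shows "bij_betw state_walk_to_necklace_walk (walks_from (state_graph d L) n u)
    (walks_from (necklace_graph d L) n (necklace u))"
  using covering_bij_betw_walks[OF necklace_covering] assms
  by (simp add: state_walk_to_necklace_walk_def state_graph_def)

lemma rev_compl_walk_bij_betw:
  assumes "u \<in> states d L"
  shows "bij_betw rev_compl_walk (walks_from (state_graph d L) n u)
    (walks_from (state_graph L d) n (rev_compl u))"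
  using covering_bij_betw_walks[OF rev_compl_covering] assms
  by (simp add: rev_compl_walk_def state_graph_def)

theorem theorem3p10:
  fixes d L n :: nat and \<alpha> \<alpha>' :: "int \<Rightarrow> int" and x y :: "nat list" and u :: "bool list"
  assumes "d \<ge> 1" and "L \<ge> 1"
    and "\<alpha> \<in> cylindric_shapes d L"
    and "x = gaps d \<alpha>"
    and "u = gap_string x"
    and "\<alpha>' = conjugate \<alpha>"
    and "y = gaps L \<alpha>'"
  shows "bij_betw (tableau_to_simplex_walk d L n \<alpha>)
           (SCT d L n \<alpha>) (walks_from (simplex_graph d L) n x) \<and>
         bij_betw (tableau_to_state_walk d L n \<alpha>)
           (SCT d L n \<alpha>) (walks_from (state_graph d L) n u) \<and>
         bij_betw state_walk_to_necklace_walk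
           (walks_from (state_graph d L) n u) (walks_from (necklace_graph d L) n (necklace u)) \<and>
         bij_betw (conjugate_tableau d L \<alpha>)
           (SCT d L n \<alpha>) (SCT L d n \<alpha>') \<and>
         bij_betw (tableau_to_simplex_walk L d n \<alpha>')
           (SCT L d n \<alpha>') (walks_from (simplex_graph L d) n y) \<and>
         bij_betw rev_compl_walk
           (walks_from (state_graph d L) n u) (walks_from (state_graph L d) n (rev_compl u)) \<and>
         bij_betw state_walk_to_necklace_walk
           (walks_from (state_graph L d) n (rev_compl u))
           (walks_from (necklace_graph L d) n (necklace (rev_compl u)))"
proof -
  have u: "u \<in> states d L"
    using shape_state_in_states[OF assms(1,3), of "\<alpha> 0"] shape_state_eq_gap_string[OF assms(3)] assms(4,5)
    by simp
  show ?thesis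
    unfolding assms(4,6,7)
    using tableau_to_simplex_walk_bij_betw[OF assms(1-3)]
      tableau_to_state_walk_bij_betw[OF assms(1-3)]
      state_walk_to_necklace_walk_bij_betw[OF u]
      conjugate_tableau_bij_betw[OF assms(1-3)]
      tableau_to_simplex_walk_bij_betw[OF assms(2,1) conjugate_in_shapes[OF assms(1-3)]]
      rev_compl_walk_bij_betw[OF u]
      state_walk_to_necklace_walk_bij_betw[OF rev_compl_in_states[OF u]]
    by (simp add: assms(4,5))
qed

end
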